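(* Suppose that $\mathcal V$ is an operator system and that $p \in \mathcal V$ is an abstract projection. Then there exists a unital complete order embedding $\pi: \mathcal V \rightarrow B(H)$ such that $\pi(p)$ is a projection in $B(H)$.
   Context: Let $(\mathcal V, \{C_n\}_n, e)$ be an abstract operator system. For a positive contraction $p \in \mathcal V$ (i.e. $0 \leq p \leq e$) let $\alpha_m(p) = \sup\{|\varphi(p)| : \varphi \text{ a state on } \mathcal V\}$ be the minimal order norm, and set $q = e - p$. For each $n$ define the cone $C((p \oplus q)_n) = \{ x \in M_{2n}(\mathcal V) : x = x^*, \ \forall \epsilon > 0 \ \exists t > 0 \text{ such that } x + \epsilon (p\oplus q)_n + t (q \oplus p)_n \in C_{2n}\}$, where $(p\oplus q)_n = I_n \otimes (p \oplus q)$, and let $J_{p \oplus q} = \operatorname{span}\big(C(p\oplus q) \cap -C(p \oplus q)\big) \subseteq M_2(\mathcal V)$. When $\alpha_m(p)=1$, the quotient $M_2(\mathcal V)/J_{p\oplus q}$, with matrix cones given by the images of the cones $C((p\oplus q)_n)$ and order unit $(p \oplus q) + J_{p\oplus q}$, is an operator system. The element $p$ is called an abstract projection if $0 \leq p \leq e$, $\alpha_m(p) = 1$, and the map $\pi_p: \mathcal V \to M_2(\mathcal V)/J_{p\oplus q}$, $\pi_p(x) = \begin{pmatrix} x & x \\ x & x \end{pmatrix} + J_{p \oplus q}$, is a complete order isomorphism. *)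

theory Defs
  imports "HOL-Analysis.Analysis" "HOL-Library.Function_Algebras"
begin

text \<open>An abstract operator system is modelled on a type 'v of class ab_group_add together
with a complex scalar multiplication sm (a complex module), an involution st, matrix
cones C n (n \<ge> 1) and a unit e.  An element of M_n(V) is a function nat \<Rightarrow> nat \<Rightarrow> 'v
vanishing outside the index square {0..<n} x {0..<n}.  Sums/differences of matrices are
the pointwise operations on functions.\<close>

definition msupp :: "nat \<Rightarrow> (nat \<Rightarrow> nat \<Rightarrow> 'v::zero) \<Rightarrow> bool" where
  "msupp n X \<longleftrightarrow> (\<forall>i j. (n \<le> i \<or> n \<le> j) \<longrightarrow> X i j = 0)"

definition msc :: "(complex \<Rightarrow> 'v \<Rightarrow> 'v) \<Rightarrow> complex \<Rightarrow> (nat \<Rightarrow> nat \<Rightarrow> 'v) \<Rightarrow> (nat \<Rightarrow> nat \<Rightarrow> 'v)" where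
  "msc sm c X = (\<lambda>i j. sm c (X i j))"

definition mstar :: "('v \<Rightarrow> 'v) \<Rightarrow> (nat \<Rightarrow> nat \<Rightarrow> 'v) \<Rightarrow> (nat \<Rightarrow> nat \<Rightarrow> 'v)" where
  "mstar st X = (\<lambda>i j. st (X j i))"

definition mcomp :: "(complex \<Rightarrow> 'v::comm_monoid_add \<Rightarrow> 'v) \<Rightarrow> nat \<Rightarrow> nat \<Rightarrow> (nat \<Rightarrow> nat \<Rightarrow> complex)
    \<Rightarrow> (nat \<Rightarrow> nat \<Rightarrow> 'v) \<Rightarrow> (nat \<Rightarrow> nat \<Rightarrow> 'v)" where
  "mcomp sm n m A X = (\<lambda>k l. if k < m \<and> l < m then
      (\<Sum>i<n. \<Sum>j<n. sm (cnj (A i k) * A j l) (X i j)) else 0)"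

definition munit :: "nat \<Rightarrow> 'v::zero \<Rightarrow> (nat \<Rightarrow> nat \<Rightarrow> 'v)" where
  "munit n e = (\<lambda>i j. if i = j \<and> i < n then e else 0)"

definition mat1 :: "'v::zero \<Rightarrow> (nat \<Rightarrow> nat \<Rightarrow> 'v)" where
  "mat1 x = (\<lambda>i j. if i = 0 \<and> j = 0 then x else 0)"

definition operator_system ::
  "(complex \<Rightarrow> 'v::ab_group_add \<Rightarrow> 'v) \<Rightarrow> ('v \<Rightarrow> 'v) \<Rightarrow> (nat \<Rightarrow> (nat \<Rightarrow> nat \<Rightarrow> 'v) set) \<Rightarrow> 'v \<Rightarrow> bool" where
  "operator_system sm st C e \<longleftrightarrow>
     module sm \<and>
     (\<forall>x. st (st x) = x) \<and> (\<forall>x y. st (x + y) = st x + st y) \<and>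
     (\<forall>c x. st (sm c x) = sm (cnj c) (st x)) \<and>
     (\<forall>n>0. C n \<subseteq> {X. msupp n X \<and> mstar st X = X}) \<and>
     (\<forall>n>0. \<forall>X\<in>C n. \<forall>Y\<in>C n. X + Y \<in> C n) \<and>
     (\<forall>n>0. \<forall>m>0. \<forall>A X. X \<in> C n \<longrightarrow> mcomp sm n m A X \<in> C m) \<and>
     (\<forall>n>0. \<forall>X. X \<in> C n \<and> - X \<in> C n \<longrightarrow> X = 0) \<and>
     st e = e \<and>
     (\<forall>n>0. \<forall>X. msupp n X \<and> mstar st X = X \<longrightarrow>
         (\<exists>r::real>0. msc sm (complex_of_real r) (munit n e) + X \<in> C n)) \<and>
     (\<forall>n>0. \<forall>X. msupp n X \<and> mstar st X = X \<and>
         (\<forall>\<epsilon>::real>0. X + msc sm (complex_of_real \<epsilon>) (munit n e) \<in> C n) \<longrightarrow> X \<in> C n)"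

definition is_state ::
  "(complex \<Rightarrow> 'v::ab_group_add \<Rightarrow> 'v) \<Rightarrow> (nat \<Rightarrow> (nat \<Rightarrow> nat \<Rightarrow> 'v) set) \<Rightarrow> 'v \<Rightarrow> ('v \<Rightarrow> complex) \<Rightarrow> bool" where
  "is_state sm C e \<phi> \<longleftrightarrow>
     (\<forall>a b x y. \<phi> (sm a x + sm b y) = a * \<phi> x + b * \<phi> y) \<and>
     \<phi> e = 1 \<and>
     (\<forall>x. mat1 x \<in> C 1 \<longrightarrow> Im (\<phi> x) = 0 \<and> 0 \<le> Re (\<phi> x))"

definition alpha_m ::
  "(complex \<Rightarrow> 'v::ab_group_add \<Rightarrow> 'v) \<Rightarrow> (nat \<Rightarrow> (nat \<Rightarrow> nat \<Rightarrow> 'v) set) \<Rightarrow> 'v \<Rightarrow> 'v \<Rightarrow> real" where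
  "alpha_m sm C e p = Sup {cmod (\<phi> p) | \<phi>. is_state sm C e \<phi>}"

text \<open>(p \<oplus> q)_n = I_n \<otimes> (p \<oplus> q) in M_{2n}(V): row/column index 2i + a with a \<in> {0,1}
for block i.\<close>
definition pq_n :: "nat \<Rightarrow> 'v::zero \<Rightarrow> 'v \<Rightarrow> (nat \<Rightarrow> nat \<Rightarrow> 'v)" where
  "pq_n n p q = (\<lambda>a b. if a = b \<and> a < 2 * n then (if even a then p else q) else 0)"

definition cone_pq ::
  "(complex \<Rightarrow> 'v::ab_group_add \<Rightarrow> 'v) \<Rightarrow> ('v \<Rightarrow> 'v) \<Rightarrow> (nat \<Rightarrow> (nat \<Rightarrow> nat \<Rightarrow> 'v) set)
     \<Rightarrow> 'v \<Rightarrow> 'v \<Rightarrow> nat \<Rightarrow> (nat \<Rightarrow> nat \<Rightarrow> 'v) set" where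
  "cone_pq sm st C p q n = {X. msupp (2 * n) X \<and> mstar st X = X \<and>
     (\<forall>\<epsilon>::real>0. \<exists>t::real>0.
        X + msc sm (complex_of_real \<epsilon>) (pq_n n p q) + msc sm (complex_of_real t) (pq_n n q p)
          \<in> C (2 * n))}"

definition J_pq ::
  "(complex \<Rightarrow> 'v::ab_group_add \<Rightarrow> 'v) \<Rightarrow> ('v \<Rightarrow> 'v) \<Rightarrow> (nat \<Rightarrow> (nat \<Rightarrow> nat \<Rightarrow> 'v) set)
     \<Rightarrow> 'v \<Rightarrow> 'v \<Rightarrow> (nat \<Rightarrow> nat \<Rightarrow> 'v) set" where
  "J_pq sm st C p q = {Y. \<exists>(m::nat) (c::nat \<Rightarrow> complex) Ys.
      (\<forall>k<m. Ys k \<in> cone_pq sm st C p q 1 \<and> - Ys k \<in> cone_pq sm st C p q 1) \<and>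
      Y = (\<lambda>i j. \<Sum>k<m. sm (c k) (Ys k i j))}"

definition pi2 :: "'v::zero \<Rightarrow> (nat \<Rightarrow> nat \<Rightarrow> 'v)" where
  "pi2 x = (\<lambda>i j. if i < 2 \<and> j < 2 then x else 0)"

definition blk :: "(nat \<Rightarrow> nat \<Rightarrow> 'v::zero) \<Rightarrow> nat \<Rightarrow> nat \<Rightarrow> (nat \<Rightarrow> nat \<Rightarrow> 'v)" where
  "blk Z i j = (\<lambda>a b. if a < 2 \<and> b < 2 then Z (2 * i + a) (2 * j + b) else 0)"

text \<open>An n x n matrix [Y_ij + J] over the quotient M_2(V)/J lies in the n-th quotient cone
iff it is the image of some element of C((p \<oplus> q)_n).\<close>
definition quot_cone_mem ::
  "(complex \<Rightarrow> 'v::ab_group_add \<Rightarrow> 'v) \<Rightarrow> ('v \<Rightarrow> 'v) \<Rightarrow> (nat \<Rightarrow> (nat \<Rightarrow> nat \<Rightarrow> 'v) set)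
     \<Rightarrow> 'v \<Rightarrow> 'v \<Rightarrow> nat \<Rightarrow> (nat \<Rightarrow> nat \<Rightarrow> (nat \<Rightarrow> nat \<Rightarrow> 'v)) \<Rightarrow> bool" where
  "quot_cone_mem sm st C p q n Y \<longleftrightarrow>
     (\<exists>Z\<in>cone_pq sm st C p q n. \<forall>i<n. \<forall>j<n. blk Z i j - Y i j \<in> J_pq sm st C p q)"

definition abstract_projection ::
  "(complex \<Rightarrow> 'v::ab_group_add \<Rightarrow> 'v) \<Rightarrow> ('v \<Rightarrow> 'v) \<Rightarrow> (nat \<Rightarrow> (nat \<Rightarrow> nat \<Rightarrow> 'v) set)
     \<Rightarrow> 'v \<Rightarrow> 'v \<Rightarrow> bool" where
  "abstract_projection sm st C e p \<longleftrightarrow>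
     (let q = e - p; J = J_pq sm st C p q in
       mat1 p \<in> C 1 \<and> mat1 (e - p) \<in> C 1 \<and> alpha_m sm C e p = 1 \<and>
       \<comment> \<open>\<pi>_p is injective into M_2(V)/J\<close>
       (\<forall>x y. pi2 x - pi2 y \<in> J \<longrightarrow> x = y) \<and>
       \<comment> \<open>\<pi>_p is surjective onto M_2(V)/J\<close>
       (\<forall>Y. msupp 2 Y \<longrightarrow> (\<exists>x. Y - pi2 x \<in> J)) \<and>
       \<comment> \<open>\<pi>_p and its inverse are completely positive\<close>
       (\<forall>n>0. \<forall>X. msupp n X \<longrightarrow>
          (X \<in> C n \<longleftrightarrow> quot_cone_mem sm st C p q n (\<lambda>i j. pi2 (X i j)))))"

definition l2 :: "'i set \<Rightarrow> ('i \<Rightarrow> complex) set" where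
  "l2 I = {f. (\<forall>i. i \<notin> I \<longrightarrow> f i = 0) \<and> (\<lambda>i. (cmod (f i))\<^sup>2) summable_on I}"

definition l2_inner :: "'i set \<Rightarrow> ('i \<Rightarrow> complex) \<Rightarrow> ('i \<Rightarrow> complex) \<Rightarrow> complex" where
  "l2_inner I f g = infsum (\<lambda>i. cnj (f i) * g i) I"

definition l2_norm :: "'i set \<Rightarrow> ('i \<Rightarrow> complex) \<Rightarrow> real" where
  "l2_norm I f = sqrt (infsum (\<lambda>i. (cmod (f i))\<^sup>2) I)"

text \<open>T \<in> B(\<ell>^2(I)); operators are compared on \<ell>^2(I) only.\<close>
definition bounded_op :: "'i set \<Rightarrow> (('i \<Rightarrow> complex) \<Rightarrow> ('i \<Rightarrow> complex)) \<Rightarrow> bool" where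
  "bounded_op I T \<longleftrightarrow>
     (\<forall>f\<in>l2 I. T f \<in> l2 I) \<and>
     (\<forall>f\<in>l2 I. \<forall>g\<in>l2 I. \<forall>a b. T (\<lambda>i. a * f i + b * g i) = (\<lambda>i. a * T f i + b * T g i)) \<and>
     (\<exists>K. \<forall>f\<in>l2 I. l2_norm I (T f) \<le> K * l2_norm I f)"

definition op_mat_pos :: "'i set \<Rightarrow> nat \<Rightarrow> (nat \<Rightarrow> nat \<Rightarrow> (('i \<Rightarrow> complex) \<Rightarrow> ('i \<Rightarrow> complex))) \<Rightarrow> bool" where
  "op_mat_pos I n T \<longleftrightarrow>
     (\<forall>fs. (\<forall>k<n. fs k \<in> l2 I) \<longrightarrow>
        (let s = (\<Sum>i<n. \<Sum>j<n. l2_inner I (fs i) (T i j (fs j))) in Im s = 0 \<and> 0 \<le> Re s))"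

definition is_projection :: "'i set \<Rightarrow> (('i \<Rightarrow> complex) \<Rightarrow> ('i \<Rightarrow> complex)) \<Rightarrow> bool" where
  "is_projection I P \<longleftrightarrow> bounded_op I P \<and>
     (\<forall>f\<in>l2 I. P (P f) = P f) \<and>
     (\<forall>f\<in>l2 I. \<forall>g\<in>l2 I. l2_inner I (P f) g = l2_inner I f (P g))"

definition unital_complete_order_embedding ::
  "(complex \<Rightarrow> 'v::ab_group_add \<Rightarrow> 'v) \<Rightarrow> (nat \<Rightarrow> (nat \<Rightarrow> nat \<Rightarrow> 'v) set) \<Rightarrow> 'v \<Rightarrow> 'i set
     \<Rightarrow> ('v \<Rightarrow> ('i \<Rightarrow> complex) \<Rightarrow> ('i \<Rightarrow> complex)) \<Rightarrow> bool" where
  "unital_complete_order_embedding sm C e I \<pi> \<longleftrightarrow>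
     (\<forall>x. bounded_op I (\<pi> x)) \<and>
     (\<forall>a b x y. \<forall>f\<in>l2 I. \<pi> (sm a x + sm b y) f = (\<lambda>i. a * \<pi> x f i + b * \<pi> y f i)) \<and>
     (\<forall>f\<in>l2 I. \<pi> e f = f) \<and>
     (\<forall>x y. (\<forall>f\<in>l2 I. \<pi> x f = \<pi> y f) \<longrightarrow> x = y) \<and>
     (\<forall>n>0. \<forall>X. msupp n X \<longrightarrow> (X \<in> C n \<longleftrightarrow> op_mat_pos I n (\<lambda>i j. \<pi> (X i j))))"

end

theory Submission
  imports Defs
begin

text \<open>
  Let X be a hermitian matrix outside C n and Z the matrix over M_2(V) whose blocks are
  \<open>\<pi>_p(X_ij)\<close>. Since p is an abstract projection, Z is not in the cone of \<open>p \<oplus> q\<close>, and a Hahn-Banach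
  argument yields a state \<open>\<phi>\<close> of M_{2n}(V) that vanishes on \<open>(q \<oplus> p)_n\<close> and is negative at Z.
  The matrix \<open>F(x)_{kl} = \<phi>(E_kl \<otimes> x)\<close> defines a completely positive map V \<open>\<rightarrow>\<close> M_{2n}. As \<open>\<phi>\<close> kills
  \<open>(q \<oplus> p)_n\<close>, positivity forces F(p) and F(q) to be the diagonal blocks of F(e) on the even and
  odd indices. Dividing \<open>\<complex>^{2n}\<close> by the null vectors of F(e) turns F into a unital completely positive
  map for which p becomes the projection onto the even part, and this map still detects that X is
  not positive. The direct sum of all such finite-dimensional maps is the required embedding.
\<close>

section \<open>Separation of a point from a cone with order unit\<close>

text \<open>Non-membership of Z in the cone of p \<oplus> q means: for some \<epsilon> > 0 no
  multiple t (q \<oplus> p)_n brings Z + \<epsilon> (p \<oplus> q)_n into the matrix cone. As t is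
  arbitrary, one can separate from the cone enlarged by all real multiples of (q \<oplus> p)_n,
  which is why \<phi> vanishes there. As (p \<oplus> q)_n + (q \<oplus> p)_n is the unit, \<phi>
  equals 1 at (p \<oplus> q)_n, so a weak inequality at Z + \<epsilon> (p \<oplus> q)_n becomes a
  strict one at Z. Two obstacles shape the rest. For each x the maps need a common bound, or their
  direct sum would be unbounded; it comes from positivity of the 2 x 2 matrix with diagonal k e and
  with x and its adjoint off the diagonal. And the embedding must characterise the cones among all
  matrices, hermitian or not, on a space \<open>l2 I\<close> whose index type is prescribed; so
  non-hermitian X need an argument of their own, and the blocks are coded as sets of functions on
  V.\<close>

lemma cone_separation:
  fixes scl :: "real \<Rightarrow> 'w::ab_group_add \<Rightarrow> 'w"
  assumes "module scl"
    and add: "\<And>x y. x \<in> D \<Longrightarrow> y \<in> D \<Longrightarrow> x + y \<in> D"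
    and scale: "\<And>r x. 0 \<le> r \<Longrightarrow> x \<in> D \<Longrightarrow> scl r x \<in> D"
    and unit: "\<And>x. \<exists>r>0. scl r u + x \<in> D"
    and y: "y \<notin> D"
  obtains f where "\<And>x x'. f (x + x') = f x + f x'" "\<And>r x. f (scl r x) = r * f x"
    "f u = (1::real)" "\<And>x. x \<in> D \<Longrightarrow> 0 \<le> f x" "f y \<le> 0"
proof -
  interpret module scl by fact
  define cone where "cone K \<longleftrightarrow> (\<forall>x\<in>K. \<forall>y\<in>K. x + y \<in> K) \<and> (\<forall>r\<ge>0. \<forall>x\<in>K. scl r x \<in> K)" for K
  have adjoin: "cone {d + scl s a | d s. d \<in> K \<and> 0 \<le> s}" if K: "cone K" for K a
    unfolding cone_def
  proof safe
    fix d s d' s' assume h: "d \<in> K" "0 \<le> (s::real)" "d' \<in> K" "0 \<le> (s'::real)"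
    have "d + scl s a + (d' + scl s' a) = (d + d') + scl (s + s') a"
      by (simp add: scale_left_distrib algebra_simps)
    then show "\<exists>d'' s''. d + scl s a + (d' + scl s' a) = d'' + scl s'' a \<and> d'' \<in> K \<and> 0 \<le> s''"
      using h K unfolding cone_def by (metis add_nonneg_nonneg)
  next
    fix r d s assume h: "0 \<le> (r::real)" "d \<in> K" "0 \<le> (s::real)"
    have "scl r (d + scl s a) = scl r d + scl (r * s) a"
      by (simp add: scale_right_distrib)
    then show "\<exists>d' s'. scl r (d + scl s a) = d' + scl s' a \<and> d' \<in> K \<and> 0 \<le> s'"
      using h K unfolding cone_def by (metis mult_nonneg_nonneg)
  qed
  have coneD: "cone D" using add scale by (auto simp: cone_def)
  obtain r0 where r0: "r0 > 0" "scl r0 u \<in> D" using unit[of 0] by auto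
  have uD: "u \<in> D" using scale[of "1/r0" "scl r0 u"] r0 by simp
  have zD: "0 \<in> D" using scale[of 0 u] uD by simp
  \<comment> \<open>Adjoining -y makes f y \<le> 0 automatic for a functional nonnegative on the
    enlarged cone. That cone still omits -u: an equation -u = d - s y would put y = (d + u)/s into D
    if s > 0, and would make D the whole space if s = 0.\<close>
  define D1 where "D1 = {d + scl s (-y) | d s. d \<in> D \<and> 0 \<le> s}"
  have c1: "cone D1" unfolding D1_def by (rule adjoin[OF coneD])
  have sub: "D \<subseteq> D1" unfolding D1_def by (force intro: exI[of _ "0::real"])
  have my: "-y \<in> D1" unfolding D1_def using zD by (force intro: exI[of _ "1::real"])
  have mu1: "-u \<notin> D1"
  proof
    assume "-u \<in> D1"
    then obtain d s where ds: "-u = d + scl s (-y)" "d \<in> D" "0 \<le> s" by (auto simp: D1_def)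
    show False
    proof (cases "s = 0")
      case True
      then have mu: "-u \<in> D" using ds by simp
      obtain r where r: "r > 0" "scl r u + y \<in> D" using unit by blast
      have "scl r (-u) + (scl r u + y) \<in> D" by (rule add[OF scale[OF less_imp_le[OF r(1)] mu] r(2)])
      then show False using y by simp
    next
      case False
      then have s: "s > 0" using ds by simp
      have "scl s y = d + u" using ds(1) by (simp add: algebra_simps)
      then have "y = scl (1/s) (d + u)" using s by (metis divide_self_if less_irrefl scale_one scale_scale times_divide_eq_left mult_1)
      then show False using y scale[of "1/s" "d + u"] add[OF ds(2) uD] s by simp
    qed
  qed
  define \<K> where "\<K> = {K. cone K \<and> D1 \<subseteq> K \<and> -u \<notin> K}"
  have "\<exists>M\<in>\<K>. \<forall>X\<in>\<K>. M \<subseteq> X \<longrightarrow> X = M"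
  proof (rule subset_Zorn_nonempty)
    show "\<K> \<noteq> {}" using c1 mu1 by (auto simp: \<K>_def)
  next
    fix \<C> assume ne: "\<C> \<noteq> {}" and ch: "subset.chain \<K> \<C>"
    have sub: "\<C> \<subseteq> \<K>" and tot: "\<And>A B. A \<in> \<C> \<Longrightarrow> B \<in> \<C> \<Longrightarrow> A \<subseteq> B \<or> B \<subseteq> A"
      using ch by (auto simp: subset_chain_def)
    have "cone (\<Union>\<C>)" unfolding cone_def
    proof safe
      fix x y A B assume "x \<in> A" "A \<in> \<C>" "y \<in> B" "B \<in> \<C>"
      then obtain K where K: "K \<in> \<C>" "x \<in> K" "y \<in> K" using tot by blast
      then have "cone K" using sub by (auto simp: \<K>_def)
      then show "x + y \<in> \<Union>\<C>" using K by (auto simp: cone_def)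
    next
      fix r x A assume A: "0 \<le> (r::real)" "x \<in> A" "A \<in> \<C>"
      then have "cone A" using sub by (auto simp: \<K>_def)
      then show "scl r x \<in> \<Union>\<C>" using A by (meson UnionI cone_def)
    qed
    then show "\<Union>\<C> \<in> \<K>" using ne sub by (auto simp: \<K>_def)
  qed
  then obtain M where M: "M \<in> \<K>" "\<And>X. X \<in> \<K> \<Longrightarrow> M \<subseteq> X \<Longrightarrow> X = M" by blast
  have cM: "cone M" and DM: "D \<subseteq> M" and myM: "-y \<in> M" and muM: "-u \<notin> M"
    using M(1) sub my by (auto simp: \<K>_def)
  have addM: "\<And>x y. x \<in> M \<Longrightarrow> y \<in> M \<Longrightarrow> x + y \<in> M"
    and sclM: "\<And>r x. 0 \<le> r \<Longrightarrow> x \<in> M \<Longrightarrow> scl r x \<in> M" using cM by (auto simp: cone_def)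
  have uM: "u \<in> M" and zM: "0 \<in> M" using uD zD DM by auto
  \<comment> \<open>By maximality of M, adjoining any a outside M must produce -u.\<close>
  have step: "\<exists>d\<in>M. \<exists>s>0. -u = d + scl s a" if a: "a \<notin> M" for a
  proof -
    define N where "N = {d + scl s a | d s. d \<in> M \<and> 0 \<le> s}"
    have MN: "M \<subseteq> N" unfolding N_def by (force intro: exI[of _ "0::real"])
    have aN: "a \<in> N" unfolding N_def using zM by (force intro: exI[of _ "1::real"])
    have cN: "cone N" unfolding N_def by (rule adjoin[OF cM])
    have "-u \<in> N"
    proof (rule ccontr)
      assume "-u \<notin> N"
      then have "N \<in> \<K>" using cN MN M(1) by (auto simp: \<K>_def)
      then show False using M(2) MN aN a by blast
    qed
    then obtain d s where ds: "-u = d + scl s a" "d \<in> M" "0 \<le> s" by (auto simp: N_def)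
    then have "s > 0" using muM by (cases "s = 0") auto
    then show ?thesis using ds(1,2) by blast
  qed
  \<comment> \<open>Weighting the two expressions for -u by s' and s cancels a, so a positive
    multiple of -u would lie in M.\<close>
  have total: "a \<in> M \<or> -a \<in> M" for a
  proof (rule ccontr)
    assume "\<not> ?thesis"
    then obtain d s d' s' where h: "d \<in> M" "s > 0" "-u = d + scl s a" "d' \<in> M" "s' > 0" "-u = d' + scl s' (-a)"
      using step[of a] step[of "-a"] by blast
    have "scl (s + s') (-u) = scl s' (d + scl s a) + scl s (d' + scl s' (-a))"
      unfolding h(3)[symmetric] h(6)[symmetric] by (simp add: scale_left_distrib)
    also have "\<dots> = scl s' d + scl s d'"
      by (simp add: scale_right_distrib scale_right_diff_distrib mult.commute)
    finally have "scl (s + s') (-u) = scl s' d + scl s d'" .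
    then have *: "scl (s + s') (-u) \<in> M" using h addM sclM by (metis less_imp_le)
    have "scl (1/(s + s')) (scl (s + s') (-u)) = -u"
      unfolding scale_scale using h(2,5) by simp
    moreover have "scl (1/(s + s')) (scl (s + s') (-u)) \<in> M"
      using h(2,5) by (intro sclM *) simp
    ultimately show False using muM by simp
  qed
  have ru: "scl r u \<in> M \<longleftrightarrow> 0 \<le> r" for r
  proof
    assume r: "scl r u \<in> M"
    show "0 \<le> r"
    proof (rule ccontr)
      assume "\<not> 0 \<le> r"
      then have "scl (1/(-r)) (scl r u) = -u" unfolding scale_scale by simp
      moreover have "scl (1/(-r)) (scl r u) \<in> M"
        by (rule sclM[OF _ r]) (use \<open>\<not> 0 \<le> r\<close> in simp)
      ultimately show False using muM by simp
    qed
  qed (use sclM uM in auto)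
  \<comment> \<open>M orders the space totally, and f x is the place of x on the scale of multiples
    of u. Totality makes the infimum also the supremum of all r with x - r u in M; the two
    descriptions give the two halves of additivity.\<close>
  define f where "f x = Inf {r. scl r u - x \<in> M}" for x
  have ne: "{r. scl r u - x \<in> M} \<noteq> {}" for x
    using unit[of "-x"] DM by auto
  have bdd: "bdd_below {r. scl r u - x \<in> M}" for x
  proof -
    obtain r where r: "scl r u + x \<in> M" using unit[of x] DM by auto
    have "-r \<le> s" if "scl s u - x \<in> M" for s
    proof -
      have "scl (s + r) u = (scl s u - x) + (scl r u + x)" by (simp add: scale_left_distrib)
      then have "scl (s + r) u \<in> M" using addM[OF that r] by (simp only:)
      then show ?thesis using ru by simp
    qed
    then show ?thesis by (intro bdd_belowI[of _ "-r"]) simp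
  qed
  have up: "scl r u - x \<in> M" if fxr: "f x < r" for r x
  proof -
    obtain s where s: "s < r" "scl s u - x \<in> M"
      using cInf_lessD[OF ne fxr[unfolded f_def]] by blast
    have eq: "scl r u - x = scl (r - s) u + (scl s u - x)" by (simp add: scale_left_diff_distrib)
    have "scl (r - s) u \<in> M" using ru s(1) by simp
    then show ?thesis unfolding eq using s(2) by (rule addM)
  qed
  have dn: "x - scl r u \<in> M" if "r < f x" for r x
  proof -
    have "scl r u - x \<notin> M" using that cInf_lower[OF _ bdd, of r x] unfolding f_def by auto
    then show ?thesis using total[of "scl r u - x"] by simp
  qed
  have le: "f x \<le> r" if "scl r u - x \<in> M" for r x
    using that cInf_lower[OF _ bdd, of r x] unfolding f_def by auto
  have ge: "r \<le> f x" if "x - scl r u \<in> M" for r x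
  proof (rule ccontr)
    assume "\<not> r \<le> f x"
    then obtain s where s: "f x < s" "s < r" using dense[of "f x" r] by auto
    have "scl (r - s) u = (scl r u - x) + (x - scl s u)" for r s by (simp add: scale_left_diff_distrib)
    then have "scl (s - r) u \<in> M" using addM[OF up[OF s(1)] that] by (simp only:)
    then show False using ru s by simp
  qed
  show ?thesis
  proof
    show addf: "f (x + x') = f x + f x'" for x x'
    proof (rule antisym)
      show "f (x + x') \<le> f x + f x'"
      proof (rule field_le_epsilon)
        fix \<epsilon> :: real assume e: "0 < \<epsilon>"
        have *: "f x + f x' + \<epsilon> = (f x + \<epsilon>/2) + (f x' + \<epsilon>/2)" by simp
        have "scl (f x + f x' + \<epsilon>) u - (x + x') = (scl (f x + \<epsilon>/2) u - x) + (scl (f x' + \<epsilon>/2) u - x')"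
          by (subst *) (simp only: scale_left_distrib diff_conv_add_uminus minus_add_distrib ac_simps)
        moreover have "(scl (f x + \<epsilon>/2) u - x) + (scl (f x' + \<epsilon>/2) u - x') \<in> M"
          using e by (intro addM up) auto
        ultimately show "f (x + x') \<le> f x + f x' + \<epsilon>" by (intro le) (simp only:)
      qed
      show "f x + f x' \<le> f (x + x')"
      proof (rule field_le_epsilon)
        fix \<epsilon> :: real assume e: "0 < \<epsilon>"
        have *: "f x + f x' - \<epsilon> = (f x - \<epsilon>/2) + (f x' - \<epsilon>/2)" by simp
        have "(x + x') - scl (f x + f x' - \<epsilon>) u = (x - scl (f x - \<epsilon>/2) u) + (x' - scl (f x' - \<epsilon>/2) u)"
          by (subst *) (simp only: scale_left_distrib diff_conv_add_uminus minus_add_distrib ac_simps)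
        moreover have "(x - scl (f x - \<epsilon>/2) u) + (x' - scl (f x' - \<epsilon>/2) u) \<in> M"
          using e by (intro addM dn) auto
        ultimately have "f x + f x' - \<epsilon> \<le> f (x + x')" by (intro ge) (simp only:)
        then show "f x + f x' \<le> f (x + x') + \<epsilon>" by simp
      qed
    qed
    have f0: "f 0 = 0" using addf[of 0 0] by simp
    have neg: "f (- x) = - f x" for x using addf[of x "-x"] f0 by simp
    have pos: "f (scl r x) \<le> r * f x" if r: "r > 0" for r x
    proof (rule field_le_epsilon)
      fix \<epsilon> :: real assume e: "0 < \<epsilon>"
      have "scl (r * f x + \<epsilon>) u - scl r x = scl r (scl (f x + \<epsilon>/r) u - x)"
        using r by (simp add: scale_right_diff_distrib distrib_left)
      moreover have "scl r (scl (f x + \<epsilon>/r) u - x) \<in> M"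
        using e r by (intro sclM up) auto
      ultimately show "f (scl r x) \<le> r * f x + \<epsilon>" by (intro le) (simp only:)
    qed
    have pos': "f (scl r x) = r * f x" if r: "r > 0" for r x
      using pos[OF r, of x] pos[OF r, of "-x"] by (simp add: neg)
    show "f (scl r x) = r * f x" for r x
    proof (cases "r > 0" "r = 0" rule: case_split[case_product case_split])
      case False_False
      then show ?thesis using pos'[of "-r" x] by (simp add: neg)
    qed (use pos' f0 in auto)
    have "f u \<le> 1" by (rule le) (simp add: zM)
    moreover have "1 \<le> f u" by (rule ge) (simp add: zM)
    ultimately show "f u = 1" by simp
    show "0 \<le> f x" if "x \<in> D" for x by (rule ge) (use that DM in auto)
    show "f y \<le> 0" by (rule le) (use myM in simp)
  qed
qed

section \<open>Positive sesquilinear forms\<close>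

definition sesq :: "nat \<Rightarrow> (nat \<Rightarrow> nat \<Rightarrow> complex) \<Rightarrow> (nat \<Rightarrow> complex) \<Rightarrow> (nat \<Rightarrow> complex) \<Rightarrow> complex" where
  "sesq d M u v = (\<Sum>k<d. \<Sum>l<d. cnj (u k) * M k l * v l)"

lemma sesq_cong:
  assumes "\<And>k l. k < d \<Longrightarrow> l < d \<Longrightarrow> M k l = M' k l" "\<And>k. k < d \<Longrightarrow> u k = u' k"
    "\<And>k. k < d \<Longrightarrow> v k = v' k"
  shows "sesq d M u v = sesq d M' u' v'"
  using assms by (simp add: sesq_def)

lemma sesq_add_left: "sesq d M (\<lambda>k. u k + u' k) v = sesq d M u v + sesq d M u' v"
  by (simp add: sesq_def algebra_simps sum.distrib)

lemma sesq_add_right: "sesq d M u (\<lambda>k. v k + v' k) = sesq d M u v + sesq d M u v'"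
  by (simp add: sesq_def algebra_simps sum.distrib)

lemma sesq_scale_left: "sesq d M (\<lambda>k. a * u k) v = cnj a * sesq d M u v"
  by (simp add: sesq_def sum_distrib_left mult_ac)

lemma sesq_scale_right: "sesq d M u (\<lambda>k. a * v k) = a * sesq d M u v"
  by (simp add: sesq_def sum_distrib_left mult_ac)

lemma sesq_0_left: "sesq d M (\<lambda>k. 0) v = 0"
  by (simp add: sesq_def)

lemma sesq_0_right: "sesq d M u (\<lambda>k. 0) = 0"
  by (simp add: sesq_def)

lemma sesq_diff_left: "sesq d M (\<lambda>k. u k - u' k) v = sesq d M u v - sesq d M u' v"
  by (simp add: sesq_def algebra_simps sum_subtractf)

lemma sesq_diff_right: "sesq d M u (\<lambda>k. v k - v' k) = sesq d M u v - sesq d M u v'"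
  by (simp add: sesq_def algebra_simps sum_subtractf)

lemma sesq_sum_left:
  "sesq d M (\<lambda>k. \<Sum>r<n::nat. a r * w r k) v = (\<Sum>r<n. cnj (a r) * sesq d M (w r) v)"
  by (induction n) (simp_all add: sesq_0_left sesq_add_left sesq_scale_left)

lemma sesq_sum_right:
  "sesq d M u (\<lambda>k. \<Sum>r<n::nat. a r * w r k) = (\<Sum>r<n. a r * sesq d M u (w r))"
  by (induction n) (simp_all add: sesq_0_right sesq_add_right sesq_scale_right)

lemma sesq_adjoint:
  assumes "\<And>k l. k < d \<Longrightarrow> l < d \<Longrightarrow> M' k l = cnj (M l k)"
  shows "sesq d M' u v = cnj (sesq d M v u)"
proof -
  have "cnj (sesq d M v u) = (\<Sum>k<d. \<Sum>l<d. v k * cnj (M k l) * cnj (u l))"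
    by (simp add: sesq_def)
  also have "\<dots> = (\<Sum>l<d. \<Sum>k<d. v k * cnj (M k l) * cnj (u l))"
    by (rule sum.swap)
  also have "\<dots> = sesq d M' u v"
    unfolding sesq_def by (intro sum.cong refl) (simp add: assms mult_ac)
  finally show ?thesis ..
qed

definition basis_vec :: "nat \<Rightarrow> nat \<Rightarrow> complex" where
  "basis_vec j = (\<lambda>k. if k = j then 1 else 0)"

lemma basis_vec_expand: "k < d \<Longrightarrow> x k = (\<Sum>j<d. x j * basis_vec j k)"
  by (simp add: basis_vec_def if_distrib[of "\<lambda>z. _ * z"] cong: if_cong)

lemma sesq_expand_left:
  "sesq d M x v = (\<Sum>j<d. cnj (x j) * sesq d M (basis_vec j) v)"
proof -
  have "sesq d M x v = sesq d M (\<lambda>k. \<Sum>j<d. x j * basis_vec j k) v"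
    by (rule sesq_cong) (use basis_vec_expand in auto)
  then show ?thesis by (simp add: sesq_sum_left)
qed

lemma sesq_expand_right:
  "sesq d M u x = (\<Sum>j<d. x j * sesq d M u (basis_vec j))"
proof -
  have "sesq d M u x = sesq d M u (\<lambda>k. \<Sum>j<d. x j * basis_vec j k)"
    by (rule sesq_cong) (use basis_vec_expand in auto)
  then show ?thesis by (simp add: sesq_sum_right)
qed

lemma sesq_basis: "i < d \<Longrightarrow> j < d \<Longrightarrow> sesq d M (basis_vec i) (basis_vec j) = M i j"
proof -
  assume ij: "i < d" "j < d"
  have "sesq d M (basis_vec i) (basis_vec j) = (\<Sum>k<d. if k = i then M i j else 0)"
    unfolding sesq_def using ij
    by (intro sum.cong refl) (auto simp: basis_vec_def if_distrib[of "\<lambda>z. _ * z"] cong: if_cong)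
  then show ?thesis using ij by simp
qed

text \<open>On multiples of w the quadratic term vanishes. What remains is a real-affine function of
  the multiple that is bounded below, so its linear part is zero. The case M = G is the
  Cauchy-Schwarz argument; other M arise as images \<open>T x\<close> under completely positive
  maps.\<close>

lemma sesq_null_left:
  assumes bnd: "\<And>u. 0 \<le> a * Re (sesq d G u u) + 2 * Re (sesq d M u v) + b"
    and "Re (sesq d G w w) = 0"
  shows "sesq d M w v = 0"
proof (rule ccontr)
  assume s: "sesq d M w v \<noteq> 0"
  \<comment> \<open>Chosen so that twice the real part of the linear term at c w is -(|b| + 1),
    which is less than -b.\<close>
  define t where "t = (\<bar>b\<bar> + 1) / (2 * (cmod (sesq d M w v))\<^sup>2)"
  define c where "c = - complex_of_real t * sesq d M w v"
  have G: "Re (sesq d G (\<lambda>k. c * w k) (\<lambda>k. c * w k)) = 0"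
  proof -
    have "sesq d G (\<lambda>k. c * w k) (\<lambda>k. c * w k) = (cnj c * c) * sesq d G w w"
      by (simp add: sesq_scale_left sesq_scale_right)
    also have "cnj c * c = complex_of_real ((cmod c)\<^sup>2)"
      by (metis complex_norm_square mult.commute)
    finally show ?thesis using assms(2) by simp
  qed
  have "sesq d M (\<lambda>k. c * w k) v = - complex_of_real t * (cnj (sesq d M w v) * sesq d M w v)"
    unfolding sesq_scale_left c_def by simp
  also have "cnj (sesq d M w v) * sesq d M w v = complex_of_real ((cmod (sesq d M w v))\<^sup>2)"
    by (metis complex_norm_square mult.commute)
  finally have "Re (sesq d M (\<lambda>k. c * w k) v) = - (t * (cmod (sesq d M w v))\<^sup>2)"
    by simp
  also have "\<dots> = - (\<bar>b\<bar> + 1) / 2"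
    using s by (simp add: t_def field_simps)
  finally have "2 * Re (sesq d M (\<lambda>k. c * w k) v) = - (\<bar>b\<bar> + 1)"
    by simp
  then show False using bnd[of "\<lambda>k. c * w k"] G by simp
qed

section \<open>Orthonormal systems for degenerate positive forms\<close>

definition residual :: "nat \<Rightarrow> (nat \<Rightarrow> nat \<Rightarrow> complex) \<Rightarrow> nat \<Rightarrow> (nat \<Rightarrow> nat \<Rightarrow> complex)
    \<Rightarrow> (nat \<Rightarrow> complex) \<Rightarrow> nat \<Rightarrow> complex" where
  "residual d G n w x = (\<lambda>k. x k - (\<Sum>r<n. sesq d G (w r) x * w r k))"

lemma semi_inner_null:
  assumes herm: "\<And>k l. k < d \<Longrightarrow> l < d \<Longrightarrow> G k l = cnj (G l k)"
    and pos: "\<And>u. 0 \<le> Re (sesq d G u u)"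
    and null: "Re (sesq d G w w) = 0"
  shows "sesq d G w v = 0" "sesq d G v w = 0"
proof -
  show *: "sesq d G w v = 0"
  proof (rule sesq_null_left[OF _ null])
    fix u
    have "sesq d G v u = cnj (sesq d G u v)" by (rule sesq_adjoint) (rule herm)
    then show "0 \<le> 1 * Re (sesq d G u u) + 2 * Re (sesq d G u v) + Re (sesq d G v v)"
      using pos[of "\<lambda>k. u k + v k"] by (simp add: sesq_add_left sesq_add_right)
  qed
  have "sesq d G v w = cnj (sesq d G w v)" by (rule sesq_adjoint) (rule herm)
  then show "sesq d G v w = 0" using * by simp
qed

text \<open>The form may be degenerate, so a vector whose residual has seminorm 0 is skipped instead
  of normalised, and only null residuals are claimed. A new vector z does not disturb earlier
  residuals: these are null, hence orthogonal to everything.\<close>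

lemma gram_schmidt:
  fixes g :: "nat \<Rightarrow> nat \<Rightarrow> complex"
  assumes herm: "\<And>k l. k < d \<Longrightarrow> l < d \<Longrightarrow> G k l = cnj (G l k)"
    and pos: "\<And>u. 0 \<le> Re (sesq d G u u)"
  shows "\<exists>n w. (\<forall>r<n. \<forall>s<n. sesq d G (w r) (w s) = (if r = s then 1 else 0)) \<and>
     (\<forall>i<m. Re (sesq d G (residual d G n w (g i)) (residual d G n w (g i))) = 0)"
proof (induction m)
  case 0
  show ?case by (rule exI[of _ 0]) simp
next
  case (Suc m)
  then obtain n w where orth: "\<And>r s. r < n \<Longrightarrow> s < n \<Longrightarrow> sesq d G (w r) (w s) = (if r = s then 1 else 0)"
    and null: "\<And>i. i < m \<Longrightarrow> Re (sesq d G (residual d G n w (g i)) (residual d G n w (g i))) = 0"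
    by blast
  define v where "v = residual d G n w (g m)"
  have perp: "sesq d G (w s) (residual d G n w x) = 0" if "s < n" for s x
  proof -
    have "sesq d G (w s) (residual d G n w x)
        = sesq d G (w s) x - (\<Sum>r<n. sesq d G (w r) x * sesq d G (w s) (w r))"
      by (simp add: residual_def sesq_diff_right sesq_sum_right)
    also have "(\<Sum>r<n. sesq d G (w r) x * sesq d G (w s) (w r)) = (\<Sum>r<n. if r = s then sesq d G (w s) x else 0)"
      by (intro sum.cong refl) (use orth that in auto)
    finally show ?thesis using that by simp
  qed
  show ?case
  proof (cases "Re (sesq d G v v) = 0")
    case True
    then show ?thesis using orth null unfolding v_def less_Suc_eq by blast
  next
    case False
    define \<rho> where "\<rho> = sqrt (Re (sesq d G v v))"
    have \<rho>: "\<rho> > 0" "\<rho>\<^sup>2 = Re (sesq d G v v)" using False pos[of v] by (auto simp: \<rho>_def)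
    have "sesq d G v v = cnj (sesq d G v v)" by (rule sesq_adjoint) (rule herm)
    then have "Im (sesq d G v v) = 0" by (metis Reals_cnj_iff complex_is_Real_iff)
    then have vv: "sesq d G v v = complex_of_real (\<rho>\<^sup>2)" using \<rho> by (simp add: complex_eq_iff)
    define z where "z = (\<lambda>k. complex_of_real (1/\<rho>) * v k)"
    define w' where "w' = w(n := z)"
    have zz: "sesq d G z z = 1"
      using \<rho>(1) unfolding z_def sesq_scale_left sesq_scale_right vv by (simp add: power2_eq_square)
    have wz: "sesq d G (w s) z = 0" if "s < n" for s
      using perp[OF that, of "g m"] unfolding z_def sesq_scale_right v_def[symmetric] by simp
    have zw: "sesq d G z (w s) = 0" if "s < n" for s
    proof -
      have "sesq d G z (w s) = cnj (sesq d G (w s) z)" by (rule sesq_adjoint) (rule herm)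
      then show ?thesis using wz that by simp
    qed
    have zx: "sesq d G z x = sesq d G z (residual d G n w x)" for x
      by (simp add: residual_def sesq_diff_right sesq_sum_right zw)
    have res: "residual d G (Suc n) w' x = (\<lambda>k. residual d G n w x k - sesq d G z x * z k)" for x
      by (auto simp: residual_def w'_def fun_eq_iff)
    have old: "residual d G (Suc n) w' (g i) = residual d G n w (g i)" if "i < m" for i
      using semi_inner_null(2)[OF herm pos null[OF that], of z] by (simp add: res zx[of "g i"])
    have "sesq d G z (g m) = complex_of_real \<rho>"
      using \<rho>(1) unfolding zx[of "g m"] v_def[symmetric]
      unfolding z_def sesq_scale_left vv by (simp add: power2_eq_square)
    then have new: "residual d G (Suc n) w' (g m) = (\<lambda>k. 0)"
      using \<rho>(1) by (simp add: res v_def[symmetric]) (simp add: z_def)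
    show ?thesis
    proof (intro exI[of _ "Suc n"] exI[of _ w'] conjI allI impI)
      fix r s assume "r < Suc n" "s < Suc n"
      then show "sesq d G (w' r) (w' s) = (if r = s then 1 else 0)"
        using orth zz wz zw by (auto simp: w'_def less_Suc_eq)
    next
      fix i assume "i < Suc m"
      then show "Re (sesq d G (residual d G (Suc n) w' (g i)) (residual d G (Suc n) w' (g i))) = 0"
        using null old new by (auto simp: less_Suc_eq sesq_0_left)
    qed
  qed
qed

text \<open>The \<open>w r\<close> represent an orthonormal basis of \<complex>^d modulo null
  vectors. Stating the expansion through forms M that kill null vectors on the left avoids forming
  the quotient space.\<close>

lemma orthonormal_expansion:
  assumes herm: "\<And>k l. k < d \<Longrightarrow> l < d \<Longrightarrow> G k l = cnj (G l k)"
    and pos: "\<And>u. 0 \<le> Re (sesq d G u u)"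
  obtains n :: nat and w where "\<And>r s. r < n \<Longrightarrow> s < n \<Longrightarrow> sesq d G (w r) (w s) = (if r = s then 1 else 0)"
    "\<And>M x v. (\<And>y. Re (sesq d G y y) = 0 \<Longrightarrow> sesq d M y v = 0) \<Longrightarrow>
       sesq d M x v = (\<Sum>r<n. cnj (sesq d G (w r) x) * sesq d M (w r) v)"
proof -
  obtain n w where orth: "\<And>r s. r < n \<Longrightarrow> s < n \<Longrightarrow> sesq d G (w r) (w s) = (if r = s then 1 else 0)"
    and null: "\<And>i. i < d \<Longrightarrow> Re (sesq d G (residual d G n w (basis_vec i)) (residual d G n w (basis_vec i))) = 0"
    using gram_schmidt[of d G d basis_vec, OF herm pos] by blast
  have exp: "sesq d M x v = (\<Sum>r<n. cnj (sesq d G (w r) x) * sesq d M (w r) v)"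
    if ann: "\<And>y. Re (sesq d G y y) = 0 \<Longrightarrow> sesq d M y v = 0" for M x v
  proof -
    have b: "sesq d M (basis_vec j) v = (\<Sum>r<n. cnj (sesq d G (w r) (basis_vec j)) * sesq d M (w r) v)"
      if "j < d" for j
      using ann[OF null[OF that]] by (simp add: residual_def sesq_diff_left sesq_sum_left)
    have "sesq d M x v = (\<Sum>j<d. \<Sum>r<n. cnj (x j * sesq d G (w r) (basis_vec j)) * sesq d M (w r) v)"
      by (subst sesq_expand_left) (simp add: b sum_distrib_left mult_ac)
    also have "\<dots> = (\<Sum>r<n. \<Sum>j<d. cnj (x j * sesq d G (w r) (basis_vec j)) * sesq d M (w r) v)"
      by (rule sum.swap)
    also have "\<dots> = (\<Sum>r<n. cnj (sesq d G (w r) x) * sesq d M (w r) v)"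
      by (subst (2) sesq_expand_right) (simp add: sum_distrib_right)
    finally show ?thesis .
  qed
  show ?thesis
  proof (rule that[of n w])
    show "sesq d G (w r) (w s) = (if r = s then 1 else 0)" if "r < n" "s < n" for r s
      using orth that .
    show "sesq d M x v = (\<Sum>r<n. cnj (sesq d G (w r) x) * sesq d M (w r) v)"
      if "\<And>y. Re (sesq d G y y) = 0 \<Longrightarrow> sesq d M y v = 0" for M x v
      using exp that .
  qed
qed

section \<open>Completely positive maps into matrices\<close>

lemma sum_swap4:
  "(\<Sum>k\<in>K. \<Sum>l\<in>L. \<Sum>i\<in>I. \<Sum>j\<in>J. f k l i j) = (\<Sum>i\<in>I. \<Sum>j\<in>J. \<Sum>k\<in>K. \<Sum>l\<in>L. f k l i j)"
  unfolding sum.cartesian_product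
  by (rule sum.reindex_bij_witness[of _ "\<lambda>(i, j, k, l). (k, l, i, j)" "\<lambda>(k, l, i, j). (i, j, k, l)"]) auto

definition mat_single :: "nat \<Rightarrow> nat \<Rightarrow> 'v::zero \<Rightarrow> (nat \<Rightarrow> nat \<Rightarrow> 'v)" where
  "mat_single k l x = (\<lambda>i j. if i = k \<and> j = l then x else 0)"

lemma sum_fun_apply2: "(\<Sum>a\<in>A. f a) i j = (\<Sum>a\<in>A. f a i j)"
  by (induction A rule: infinite_finite_induct) auto

lemma mat_expand:
  fixes X :: "nat \<Rightarrow> nat \<Rightarrow> 'v::comm_monoid_add"
  assumes "msupp N X"
  shows "X = (\<Sum>k<N. \<Sum>l<N. mat_single k l (X k l))"
proof (intro ext)
  fix i j
  have "(\<Sum>k<N. \<Sum>l<N. mat_single k l (X k l)) i j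
      = (\<Sum>k<N. \<Sum>l<N. if k = i then (if l = j then X i j else 0) else 0)"
    unfolding sum_fun_apply2 by (intro sum.cong refl) (auto simp: mat_single_def)
  also have "\<dots> = (\<Sum>k<N. if k = i then (\<Sum>l<N. if l = j then X i j else 0) else 0)"
    by (intro sum.cong refl) auto
  also have "\<dots> = X i j" using assms by (auto simp: msupp_def not_less)
  finally show "X i j = (\<Sum>k<N. \<Sum>l<N. mat_single k l (X k l)) i j" ..
qed

section \<open>Consequences of the operator system axioms\<close>

locale op_sys =
  fixes sm :: "complex \<Rightarrow> 'v::ab_group_add \<Rightarrow> 'v" and st C e
  assumes operator_system: "operator_system sm st C e"
begin

lemmas axioms_conj = operator_system[unfolded operator_system_def]

sublocale module sm by (rule axioms_conj[THEN conjunct1])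

lemma st_st [simp]: "st (st x) = x"
  by (rule axioms_conj[THEN conjunct2, THEN conjunct1, rule_format])

lemma st_add: "st (x + y) = st x + st y"
  by (rule axioms_conj[THEN conjunct2, THEN conjunct2, THEN conjunct1, rule_format])

lemma st_sm: "st (sm c x) = sm (cnj c) (st x)"
  by (rule axioms_conj[THEN conjunct2, THEN conjunct2, THEN conjunct2, THEN conjunct1, rule_format])

lemmas cone_axioms = axioms_conj[THEN conjunct2, THEN conjunct2, THEN conjunct2, THEN conjunct2]

lemma C_msupp: "0 < n \<Longrightarrow> X \<in> C n \<Longrightarrow> msupp n X"
  and C_herm: "0 < n \<Longrightarrow> X \<in> C n \<Longrightarrow> mstar st X = X"
  using cone_axioms[THEN conjunct1] by blast+

lemma C_add: "0 < n \<Longrightarrow> X \<in> C n \<Longrightarrow> Y \<in> C n \<Longrightarrow> X + Y \<in> C n"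
  using cone_axioms[THEN conjunct2, THEN conjunct1] by blast

lemma C_comp: "0 < n \<Longrightarrow> 0 < m \<Longrightarrow> X \<in> C n \<Longrightarrow> mcomp sm n m A X \<in> C m"
  using cone_axioms[THEN conjunct2, THEN conjunct2, THEN conjunct1] by blast

lemmas unit_axioms = cone_axioms[THEN conjunct2, THEN conjunct2, THEN conjunct2]

lemma C_antisym: "0 < n \<Longrightarrow> X \<in> C n \<Longrightarrow> - X \<in> C n \<Longrightarrow> X = 0"
  using unit_axioms[THEN conjunct1] by blast

lemma st_e [simp]: "st e = e"
  by (rule unit_axioms[THEN conjunct2, THEN conjunct1])

lemma C_unit: "0 < n \<Longrightarrow> msupp n X \<Longrightarrow> mstar st X = X \<Longrightarrow>
    \<exists>r::real>0. msc sm (complex_of_real r) (munit n e) + X \<in> C n"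
  using unit_axioms[THEN conjunct2, THEN conjunct2, THEN conjunct1] by blast

lemma st_0 [simp]: "st 0 = 0" using st_sm[of 0 0] by simp

lemma st_minus: "st (- x) = - st x" using st_sm[of "-1" x] by simp

lemma st_diff: "st (x - y) = st x - st y" using st_add[of x "-y"] by (simp add: st_minus)

text \<open>The compressing matrix has at most one nonzero entry in column k, namely
  \<open>a k\<close> in row \<open>g k\<close>. It is used with g = id for scaling, with constant g
  for placing an element on the diagonal, and with g k = k div 2 for repeating every index
  twice.\<close>

lemma mcomp_select:
  assumes "\<And>k. k < m \<Longrightarrow> g k < n"
  shows "mcomp sm n m (\<lambda>i k. if i = g k then a k else 0) X
    = (\<lambda>k l. if k < m \<and> l < m then sm (cnj (a k) * a l) (X (g k) (g l)) else 0)"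
proof (intro ext)
  fix k l
  have "(\<Sum>i<n. \<Sum>j<n. sm (cnj (if i = g k then a k else 0) * (if j = g l then a l else 0)) (X i j))
     = sm (cnj (a k) * a l) (X (g k) (g l))" if kl: "k < m" "l < m"
  proof -
    have "(\<Sum>i<n. \<Sum>j<n. sm (cnj (if i = g k then a k else 0) * (if j = g l then a l else 0)) (X i j))
      = (\<Sum>i<n. if i = g k then sm (cnj (a k) * a l) (X (g k) (g l)) else 0)"
      using assms kl
      by (intro sum.cong refl)
        (auto simp: if_distrib[of "\<lambda>z. _ * z"] if_distrib[of "\<lambda>z. sm z _"] cong: if_cong)
    also have "\<dots> = sm (cnj (a k) * a l) (X (g k) (g l))" using assms kl by simp
    finally show ?thesis .
  qed
  then show "mcomp sm n m (\<lambda>i k. if i = g k then a k else 0) X k l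
    = (if k < m \<and> l < m then sm (cnj (a k) * a l) (X (g k) (g l)) else 0)"
    by (simp add: mcomp_def)
qed

text \<open>Scaling by r is compression by sqrt r times the identity.\<close>

lemma C_scale:
  assumes "0 < n" "0 \<le> r" "X \<in> C n"
  shows "msc sm (complex_of_real r) X \<in> C n"
proof -
  have "complex_of_real (sqrt r) * complex_of_real (sqrt r) = complex_of_real r"
    using assms(2) by (metis of_real_mult real_sqrt_mult_self abs_of_nonneg)
  then have "msc sm (complex_of_real r) X = mcomp sm n n (\<lambda>i k. if i = id k then complex_of_real (sqrt r) else 0) X"
    using C_msupp[OF assms(1,3)] by (subst mcomp_select) (auto simp: msc_def msupp_def fun_eq_iff not_less)
  then show ?thesis using C_comp assms by simp
qed

lemma C_0: "0 < n \<Longrightarrow> 0 \<in> C n"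
proof -
  assume n: "0 < n"
  obtain r where "msc sm (complex_of_real r) (munit n e) + 0 \<in> C n"
    using C_unit[OF n, of 0] by (auto simp: msupp_def mstar_def fun_eq_iff)
  from C_scale[OF n order_refl this] show ?thesis by (simp add: msc_def zero_fun_def)
qed

lemma C_sum: "finite A \<Longrightarrow> 0 < n \<Longrightarrow> (\<And>a. a \<in> A \<Longrightarrow> X a \<in> C n) \<Longrightarrow> sum X A \<in> C n"
  by (induction A rule: finite_induct) (auto intro: C_0 C_add)

lemma C_single:
  assumes "mat1 x \<in> C 1" "k < N"
  shows "mat_single k k x \<in> C N"
proof -
  have "mat_single k k x = mcomp sm 1 N (\<lambda>i j. if i = (\<lambda>_. 0) j then (if j = k then 1 else 0) else 0) (mat1 x)"
    using assms(2) by (subst mcomp_select) (auto simp: mat_single_def mat1_def fun_eq_iff)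
  then show ?thesis using C_comp[of 1 N] assms by simp
qed

lemma pq_n_expand: "pq_n n x y = (\<Sum>k<2*n. mat_single k k (if even k then x else y :: 'v))"
proof (intro ext)
  fix i j
  have "(\<Sum>k<2*n. mat_single k k (if even k then x else y)) i j
      = (\<Sum>k<2*n. if k = i then (if i = j then (if even i then x else y) else 0) else 0)"
    unfolding sum_fun_apply2 by (intro sum.cong refl) (auto simp: mat_single_def)
  then show "pq_n n x y i j = (\<Sum>k<2*n. mat_single k k (if even k then x else y)) i j"
    by (simp add: pq_n_def)
qed

lemma pq_n_mem:
  assumes "0 < n" "mat1 x \<in> C 1" "mat1 y \<in> C 1"
  shows "pq_n n x y \<in> C (2 * n)"
  unfolding pq_n_expand using assms by (intro C_sum C_single) auto

text \<open>Only a weak inequality at Y is claimed, since the cone that Y is separated from need not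
  be closed. The functional is first found over the reals and then complexified.\<close>

lemma separating_functional:
  assumes N: "0 < N" and W: "W \<in> C N" and Y: "msupp N Y" "mstar st Y = Y"
    and Y_notin: "\<And>t::real. 0 < t \<Longrightarrow> Y + msc sm (complex_of_real t) W \<notin> C N"
  obtains \<phi> :: "(nat \<Rightarrow> nat \<Rightarrow> 'v) \<Rightarrow> complex" where
    "\<And>X X'. \<phi> (X + X') = \<phi> X + \<phi> X'" "\<And>c X. \<phi> (msc sm c X) = c * \<phi> X"
    "\<And>X. \<phi> (mstar st X) = cnj (\<phi> X)" "\<And>X. X \<in> C N \<Longrightarrow> 0 \<le> \<phi> X"
    "\<phi> W = 0" "\<phi> (munit N e) = 1" "Re (\<phi> Y) \<le> 0"
proof -
  let ?r = "\<lambda>r::real. msc sm (complex_of_real r)"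
  \<comment> \<open>H makes any matrix hermitian, so the cone separation applies to the full real vector space of
    all functions instead of the hermitian matrices only.\<close>
  define H where "H X = (\<lambda>i j. if i < N \<and> j < N then X i j + st (X j i) else 0)" for X
  have H_add: "H (X + X') = H X + H X'" for X X'
    by (auto simp: H_def fun_eq_iff st_add)
  have H_scale: "H (?r r X) = ?r r (H X)" for r X
    by (auto simp: H_def msc_def fun_eq_iff st_sm scale_right_distrib)
  have H_diff_star: "H (X - mstar st X) = 0" for X
    by (auto simp: H_def mstar_def fun_eq_iff st_diff)
  have H_herm: "H X = ?r 2 X" if "msupp N X" "mstar st X = X" for X
  proof -
    have "st (X j i) = X i j" for i j using that(2) by (auto simp: mstar_def fun_eq_iff)
    moreover have "sm 2 x = x + x" for x using scale_left_distrib[of 1 1 x] by simp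
    ultimately show ?thesis using that(1) by (auto simp: H_def msc_def fun_eq_iff msupp_def not_less)
  qed
  have H_range: "msupp N (H X)" "mstar st (H X) = H X" for X
    by (auto simp: H_def msupp_def mstar_def fun_eq_iff st_add add.commute)
  have unit: "msupp N (munit N e)" "mstar st (munit N e) = munit N e"
    by (auto simp: munit_def msupp_def mstar_def fun_eq_iff)
  have rr: "?r a (?r b X) = ?r (a * b) X" "?r (a + b) X = ?r a X + ?r b X" "?r 1 X = X" "?r 0 X = 0"
    "?r a (X + X') = ?r a X + ?r a X'"
    "msc sm 0 X = 0" "msc sm 1 X = X" for a b X X'
    by (auto simp: msc_def fun_eq_iff scale_left_distrib scale_right_distrib)
  \<comment> \<open>Allowing t of both signs puts W and - W into the cone, which forces the functional to kill W.\<close>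
  define D where "D = {X. \<exists>t. H X + ?r t W \<in> C N}"
  have D_C: "X \<in> D" if "X \<in> C N" for X
    using H_herm[OF C_msupp[OF N that] C_herm[OF N that]] C_scale[OF N _ that, of 2]
    unfolding D_def by (auto intro!: exI[of _ 0] simp: rr)
  obtain f where f: "\<And>X X'. f (X + X') = f X + f X'" "\<And>r X. f (?r r X) = r * f X"
    "f (munit N e) = (1::real)" "\<And>X. X \<in> D \<Longrightarrow> 0 \<le> f X" "f Y \<le> 0"
  proof (rule cone_separation[of ?r D "munit N e" Y])
    show "module ?r"
      by unfold_locales (simp_all only: rr)
    show "X + X' \<in> D" if XX: "X \<in> D" "X' \<in> D" for X X'
    proof -
      obtain t t' where "H X + ?r t W \<in> C N" "H X' + ?r t' W \<in> C N" using XX by (auto simp: D_def)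
      from C_add[OF N this] have "H (X + X') + ?r (t + t') W \<in> C N"
        by (simp only: H_add rr ac_simps)
      then show ?thesis unfolding D_def by blast
    qed
    show "?r r X \<in> D" if rX: "0 \<le> r" "X \<in> D" for r X
    proof -
      obtain t where "H X + ?r t W \<in> C N" using rX by (auto simp: D_def)
      from C_scale[OF N rX(1) this] have "H (?r r X) + ?r (r * t) W \<in> C N"
        by (simp only: H_scale rr)
      then show ?thesis unfolding D_def by blast
    qed
    show "\<exists>r>0. ?r r (munit N e) + X \<in> D" for X
    proof -
      obtain r where r: "r > 0" "?r r (munit N e) + H X \<in> C N"
        using C_unit[OF N H_range] by blast
      have "H (?r (r/2) (munit N e) + X) + ?r 0 W = ?r (r/2 * 2) (munit N e) + H X"
        by (simp only: H_add H_scale H_herm[OF unit] rr add_0_right)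
      also have "r/2 * 2 = r" by simp
      finally have "?r (r/2) (munit N e) + X \<in> D" unfolding D_def using r(2) by (intro CollectI exI[of _ 0]) (simp only:)
      then show ?thesis using r(1) by (auto intro!: exI[of _ "r/2"])
    qed
    show "Y \<notin> D"
    proof
      assume "Y \<in> D"
      then obtain t where t: "?r 2 Y + ?r t W \<in> C N" by (auto simp: D_def H_herm[OF Y])
      \<comment> \<open>The factor 1/2 undoes the doubling by \<open>H\<close>. Adding (|t| + 1) W
        makes the coefficient of W positive, as t/2 + |t| + 1 > 0, so the assumption on Y is
        contradicted.\<close>
      have "?r (1/2) (?r 2 Y + ?r t W) + ?r (\<bar>t\<bar> + 1) W \<in> C N"
        using C_scale[OF N _ t, of "1/2"] C_scale[OF N _ W, of "\<bar>t\<bar> + 1"] by (intro C_add[OF N]) auto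
      moreover have "?r (1/2) (?r 2 Y + ?r t W) + ?r (\<bar>t\<bar> + 1) W
          = ?r (1/2 * 2) Y + ?r (1/2 * t + (\<bar>t\<bar> + 1)) W"
        by (simp only: rr add.assoc)
      ultimately have "Y + ?r (t/2 + (\<bar>t\<bar> + 1)) W \<in> C N" by (simp add: rr)
      moreover have "0 < t/2 + (\<bar>t\<bar> + 1)" by linarith
      ultimately show False using Y_notin[of "t/2 + (\<bar>t\<bar> + 1)"] by auto
    qed
  qed blast
  have f_minus: "f (- X) = - f X" for X
  proof -
    have "- X = ?r (-1) X" by (auto simp: msc_def fun_eq_iff)
    then show ?thesis using f(2)[of "-1" X] by simp
  qed
  \<comment> \<open>In this case X and -X both lie in D, because 0 is in the cone.\<close>
  have f_null: "f X = 0" if "H X + ?r t W = 0" for X t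
  proof -
    have "H (- X) = - H X" by (auto simp: H_def fun_eq_iff st_minus)
    moreover have "?r (-t) W = - ?r t W" by (auto simp: msc_def fun_eq_iff)
    ultimately have "H (- X) + ?r (-t) W = - (H X + ?r t W)" by simp
    then have "H (- X) + ?r (-t) W \<in> C N" using that C_0[OF N] by simp
    then have "- X \<in> D" unfolding D_def by blast
    moreover have "X \<in> D" using that C_0[OF N] by (auto simp: D_def intro!: exI[of _ t])
    ultimately show ?thesis using f(4)[of X] f(4)[of "- X"] f_minus by simp
  qed
  have f_star: "f (mstar st X) = f X" for X
    using f_null[of "X - mstar st X" 0] f(1)[of X "- mstar st X"] by (simp add: H_diff_star rr f_minus)
  define J where "J = msc sm \<i>"
  have J: "J (X + X') = J X + J X'" "J (?r r X) = ?r r (J X)" "J (J X) = - X" "mstar st (J X) = - J (mstar st X)" for X X' r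
    by (auto simp: J_def msc_def mstar_def fun_eq_iff scale_right_distrib mult.commute st_sm)
  have msc_eq: "msc sm c X = ?r (Re c) X + ?r (Im c) (J X)" for c X
  proof (intro ext)
    fix i j
    have "sm c (X i j) = sm (complex_of_real (Re c) + complex_of_real (Im c) * \<i>) (X i j)"
      by (metis complex_eq mult.commute)
    then show "msc sm c X i j = (?r (Re c) X + ?r (Im c) (J X)) i j"
      by (simp add: J_def msc_def scale_left_distrib)
  qed
  \<comment> \<open>The usual complexification f(X) - i f(iX). Since f is invariant under the
    adjoint, f(iX) = 0 for hermitian X, so \<phi> is real there and agrees with f.\<close>
  define \<phi> where "\<phi> X = Complex (f X) (- f (J X))" for X
  have herm_real: "f (J X) = 0" if "mstar st X = X" for X
  proof -
    have "f (J X) = f (mstar st (J X))" by (simp only: f_star)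
    then show ?thesis using that by (simp add: J f_minus)
  qed
  show ?thesis
  proof
    show "\<phi> (X + X') = \<phi> X + \<phi> X'" for X X' by (simp add: \<phi>_def J f complex_eq_iff)
    show "\<phi> (msc sm c X) = c * \<phi> X" for c X
      unfolding msc_eq[of c X] by (simp add: \<phi>_def J f f_minus complex_eq_iff)
    show "\<phi> (mstar st X) = cnj (\<phi> X)" for X
    proof -
      have "J (mstar st X) = - mstar st (J X)" by (simp add: J)
      then show ?thesis by (simp add: \<phi>_def f_star f_minus complex_eq_iff)
    qed
    show "0 \<le> \<phi> X" if "X \<in> C N" for X
      using f(4)[OF D_C[OF that]] herm_real[OF C_herm[OF N that]] by (simp add: \<phi>_def less_eq_complex_def)
    have "H W + ?r (-2) W = ?r (2 + -2) W"
      unfolding H_herm[OF C_msupp[OF N W] C_herm[OF N W]] by (simp only: rr)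
    then have "H W + ?r (-2) W = 0" by (simp add: rr)
    then have "f W = 0" by (rule f_null)
    then show "\<phi> W = 0" using herm_real[OF C_herm[OF N W]] by (simp add: \<phi>_def complex_eq_iff)
    show "\<phi> (munit N e) = 1" using f(3) herm_real[OF unit(2)] by (simp add: \<phi>_def complex_eq_iff)
    show "Re (\<phi> Y) \<le> 0" using f(5) by (simp add: \<phi>_def)
  qed
qed

text \<open>Positivity of the block matrix with blocks \<open>T (X i j)\<close> is expressed by its
  form on n-tuples of vectors. Linearity is required of the entries outside the d x d corner too,
  which forces T 0 = 0 at every index; the coding of blocks by sets relies on this.\<close>

definition cp_map :: "nat \<Rightarrow> ('v \<Rightarrow> nat \<Rightarrow> nat \<Rightarrow> complex) \<Rightarrow> bool" where
  "cp_map d T \<longleftrightarrow>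
     (\<forall>a b x y r s. T (sm a x + sm b y) r s = a * T x r s + b * T y r s) \<and>
     (\<forall>x r s. T (st x) r s = cnj (T x s r)) \<and>
     (\<forall>n>0. \<forall>X\<in>C n. \<forall>c. 0 \<le> (\<Sum>i<n. \<Sum>j<n. sesq d (T (X i j)) (c i) (c j)))"

lemma cp_linear: "cp_map d T \<Longrightarrow> T (sm a x + sm b y) r s = a * T x r s + b * T y r s"
  and cp_st: "cp_map d T \<Longrightarrow> T (st x) r s = cnj (T x s r)"
  and cp_pos: "cp_map d T \<Longrightarrow> 0 < n \<Longrightarrow> X \<in> C n \<Longrightarrow>
      0 \<le> (\<Sum>i<n. \<Sum>j<n. sesq d (T (X i j)) (c i) (c j))"
  unfolding cp_map_def by blast+

lemma cp_add: "cp_map d T \<Longrightarrow> T (x + y) r s = T x r s + T y r s"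
  using cp_linear[of d T 1 x 1 y r s] by simp

lemma cp_sm: "cp_map d T \<Longrightarrow> T (sm a x) r s = a * T x r s"
  using cp_linear[of d T a x 0 x r s] by simp

lemma cp_0: "cp_map d T \<Longrightarrow> T 0 r s = 0"
  using cp_sm[of d T 0 0 r s] by simp

lemma cp_sesq_st: "cp_map d T \<Longrightarrow> sesq d (T (st x)) u v = cnj (sesq d (T x) v u)"
  by (rule sesq_adjoint) (rule cp_st)

lemma cp_sesq_sm: "cp_map d T \<Longrightarrow> sesq d (T (sm a x)) u v = a * sesq d (T x) u v"
  by (simp add: sesq_def cp_sm sum_distrib_left mult_ac)

lemma cp_sesq_add: "cp_map d T \<Longrightarrow> sesq d (T (x + y)) u v = sesq d (T x) u v + sesq d (T y) u v"
  by (simp add: sesq_def cp_add sum.distrib algebra_simps)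

lemma cp_sesq_pos:
  assumes "cp_map d T" "mat1 x \<in> C 1"
  shows "0 \<le> sesq d (T x) u u"
  using cp_pos[OF assms(1) _ assms(2), of "\<lambda>_. u"] by (simp add: mat1_def)

text \<open>For large k the matrix [[k e, x], [st x, k e]] is positive by the order unit axiom, and
  T is applied to it at the pair (u, v). The order of quantifiers matters: k depends on x only, not
  on d or T.\<close>

lemma cp_bound:
  "\<exists>k>0. \<forall>d T u v. cp_map d T \<longrightarrow>
     0 \<le> k * Re (sesq d (T e) u u) + 2 * Re (sesq d (T x) u v) + k * Re (sesq d (T e) v v)"
proof -
  define X where "X = (\<lambda>i j. if i = (0::nat) \<and> j = (1::nat) then x else if i = 1 \<and> j = 0 then st x else (0::'v))"
  have "msupp 2 X" "mstar st X = X"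
    by (auto simp: X_def msupp_def mstar_def fun_eq_iff)
  then obtain k where k: "k > 0" "msc sm (complex_of_real k) (munit 2 e) + X \<in> C 2"
    using C_unit[of 2 X] by auto
  have "0 \<le> k * Re (sesq d (T e) u u) + 2 * Re (sesq d (T x) u v) + k * Re (sesq d (T e) v v)"
    if T: "cp_map d T" for d T u v
  proof -
    have "(\<Sum>i<2. \<Sum>j<2. sesq d (T ((msc sm (complex_of_real k) (munit 2 e) + X) i j))
          (if i = 0 then u else v) (if j = 0 then u else v))
        = complex_of_real k * sesq d (T e) u u + sesq d (T x) u v + sesq d (T (st x)) v u
          + complex_of_real k * sesq d (T e) v v"
      by (simp add: numeral_2_eq_2 msc_def munit_def X_def cp_sesq_sm[OF T])
    moreover have "0 \<le> (\<Sum>i<2. \<Sum>j<2. sesq d (T ((msc sm (complex_of_real k) (munit 2 e) + X) i j))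
          (if i = (0::nat) then u else v) (if j = (0::nat) then u else v))"
      by (rule cp_pos[OF T _ k(2)]) simp
    ultimately have "0 \<le> Re (complex_of_real k * sesq d (T e) u u + sesq d (T x) u v
        + sesq d (T (st x)) v u + complex_of_real k * sesq d (T e) v v)"
      by (simp add: less_eq_complex_def)
    then show ?thesis by (simp add: cp_sesq_st[OF T])
  qed
  with k(1) show ?thesis by blast
qed

lemma cp_null_left:
  assumes "cp_map d T" "Re (sesq d (T e) w w) = 0"
  shows "sesq d (T x) w v = 0"
proof -
  obtain k where "\<And>u v. 0 \<le> k * Re (sesq d (T e) u u) + 2 * Re (sesq d (T x) u v) + k * Re (sesq d (T e) v v)"
    using cp_bound[of x] assms(1) by blast
  then show ?thesis using assms(2) by (rule sesq_null_left)
qed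

lemma cp_e_herm: "cp_map d T \<Longrightarrow> T e k l = cnj (T e l k)"
  using cp_st[of d T e k l] by simp

lemma cp_e_pos:
  assumes "cp_map d T"
  shows "0 \<le> Re (sesq d (T e) u u)"
proof -
  obtain k where "k > 0" "\<And>u v. 0 \<le> k * Re (sesq d (T e) u u) + 2 * Re (sesq d (T 0) u v)
      + k * Re (sesq d (T e) v v)"
    using cp_bound[of 0] assms by blast
  from this(2)[of u "\<lambda>_. 0"] this(1) show ?thesis by (simp add: sesq_0_right zero_le_mult_iff)
qed

text \<open>Only linearity is assumed, because the formula serves to prove that a map is completely
  positive.\<close>

lemma cp_mcomp:
  assumes T: "\<And>a b x y r s. T (sm a x + sm b y) r s = a * T x r s + b * T y r s"
    and k: "k < m" "l < m"
  shows "T (mcomp sm n m A X k l) r s = (\<Sum>i<n. \<Sum>j<n. cnj (A i k) * A j l * T (X i j) r s)"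
proof -
  have add: "T (x + y) r s = T x r s + T y r s" for x y using T[of 1 x 1 y] by simp
  have sc: "T (sm a x) r s = a * T x r s" for a x using T[of a x 0 x] by simp
  have T_0: "T 0 r s = 0" using sc[of 0 0] by simp
  have "T (sum g B) r s = (\<Sum>a\<in>B. T (g a) r s)" for g and B :: "nat set"
    by (induction B rule: infinite_finite_induct) (simp_all add: T_0 add)
  then show ?thesis using k by (simp add: mcomp_def sc)
qed

text \<open>Idempotence is all that is asked of \<open>T p\<close>; self-adjointness follows from
  \<open>cp_map\<close> once st p = p.\<close>

definition proj_block :: "'v \<Rightarrow> nat \<Rightarrow> ('v \<Rightarrow> nat \<Rightarrow> nat \<Rightarrow> complex) \<Rightarrow> bool" where
  "proj_block p d T \<longleftrightarrow> cp_map d T \<and>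
     (\<forall>r<d. \<forall>s<d. T e r s = (if r = s then 1 else 0)) \<and>
     (\<forall>r<d. \<forall>s<d. (\<Sum>t<d. T p r t * T p t s) = T p r s)"

text \<open>F e is taken as a semi-inner product on \<complex>^N. Modulo null vectors, the
  assumptions say that E is self-adjoint and idempotent for it and represents F p. In coordinates of
  an orthonormal system F e becomes the identity; L is the coordinate map.\<close>

lemma proj_block_of_cp_map:
  assumes F: "cp_map N F"
    and E_both: "\<And>u v. sesq N (F p) u v = sesq N (F e) (E u) (E v)"
    and E: "\<And>u v. sesq N (F p) u v = sesq N (F e) (E u) v" "\<And>u v. sesq N (F p) u v = sesq N (F e) u (E v)"
  obtains d T L where "proj_block p d T"
    "\<And>x u v. sesq N (F x) u v = sesq d (T x) (L u) (L v)"
proof -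
  obtain d :: nat and w where orth: "\<And>r s. r < d \<Longrightarrow> s < d \<Longrightarrow> sesq N (F e) (w r) (w s) = (if r = s then 1 else 0)"
    and exp: "\<And>M x v. (\<And>y. Re (sesq N (F e) y y) = 0 \<Longrightarrow> sesq N M y v = 0) \<Longrightarrow>
       sesq N M x v = (\<Sum>r<d. cnj (sesq N (F e) (w r) x) * sesq N M (w r) v)"
    by (rule orthonormal_expansion[of N "F e"]) (use cp_e_herm[OF F] cp_e_pos[OF F] in blast)+
  define T where "T x r s = sesq N (F x) (w r) (w s)" for x r s
  define L where "L u = (\<lambda>r. sesq N (F e) (w r) u)" for u
  have left: "sesq N (F x) u v = (\<Sum>r<d. cnj (L u r) * sesq N (F x) (w r) v)" for x u v
    unfolding L_def by (rule exp) (rule cp_null_left[OF F])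
  have right: "sesq N (F x) u v = (\<Sum>s<d. L v s * sesq N (F x) u (w s))" for x u v
  proof -
    have "sesq N (F x) u v = cnj (sesq N (F (st x)) v u)" by (simp add: cp_sesq_st[OF F])
    also have "\<dots> = (\<Sum>s<d. L v s * cnj (sesq N (F (st x)) (w s) u))" by (subst left) simp
    finally show ?thesis by (simp add: cp_sesq_st[OF F])
  qed
  have main: "sesq N (F x) u v = sesq d (T x) (L u) (L v)" for x u v
  proof -
    have "sesq N (F x) u v = (\<Sum>r<d. cnj (L u r) * (\<Sum>s<d. L v s * sesq N (F x) (w r) (w s)))"
      by (subst left) (subst right, rule refl)
    then show ?thesis by (simp add: sesq_def[of d] T_def sum_distrib_left mult_ac)
  qed
  have "proj_block p d T"
    unfolding proj_block_def
  proof (intro conjI allI impI)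
    show "cp_map d T" unfolding cp_map_def
    proof (intro conjI allI impI ballI)
      show "T (sm a x + sm b y) r s = a * T x r s + b * T y r s" for a b x y r s
        by (simp add: T_def cp_sesq_add[OF F] cp_sesq_sm[OF F])
      show "T (st x) r s = cnj (T x s r)" for x r s
        by (simp add: T_def cp_sesq_st[OF F])
      fix n :: nat and X c assume n: "0 < n" "X \<in> C n"
      \<comment> \<open>A coordinate vector a stands for the combination of the \<open>w r\<close>
        with coefficients \<open>a r\<close>, so positivity of T is positivity of F at such
        combinations.\<close>
      have "sesq d (T x) a b = sesq N (F x) (\<lambda>k. \<Sum>r<d. a r * w r k) (\<lambda>k. \<Sum>r<d. b r * w r k)" for x a b
        by (simp add: sesq_sum_left sesq_sum_right) (simp add: sesq_def[of d] T_def sum_distrib_left mult_ac)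
      then show "0 \<le> (\<Sum>i<n. \<Sum>j<n. sesq d (T (X i j)) (c i) (c j))"
        using cp_pos[OF F n] by simp
    qed
  next
    show "T e r s = (if r = s then 1 else 0)" if "r < d" "s < d" for r s
      using orth[OF that] by (simp add: T_def)
  next
    fix r s assume "r < d" "s < d"
    \<comment> \<open>\<open>T p r t\<close> becomes an inner product with \<open>E (w r)\<close>
      and \<open>T p t s\<close> one with \<open>E (w s)\<close>; the sum over t is then Parseval's
      identity.\<close>
    have "(\<Sum>t<d. T p r t * T p t s) = (\<Sum>t<d. L (E (w s)) t * sesq N (F e) (E (w r)) (w t))"
      unfolding T_def L_def by (intro sum.cong refl) (subst E(1), subst E(2), simp)
    also have "\<dots> = sesq N (F e) (E (w r)) (E (w s))" by (rule right[symmetric])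
    also have "\<dots> = T p r s" by (simp add: T_def E_both)
    finally show "(\<Sum>t<d. T p r t * T p t s) = T p r s" .
  qed
  then show ?thesis using main by (rule that)
qed

lemma separating_block:
  assumes p: "mat1 p \<in> C 1" "mat1 (e - p) \<in> C 1"
    and n: "0 < n" and X: "msupp n X" "mstar st X = X"
    and notin: "(\<lambda>a b. X (a div 2) (b div 2)) \<notin> cone_pq sm st C p (e - p) n"
  obtains d T c where "proj_block p d T"
    "\<not> 0 \<le> (\<Sum>i<n. \<Sum>j<n. sesq d (T (X i j)) (c i) (c j))"
proof -
  define N where "N = 2 * n"
  define Z where "Z = (\<lambda>a b. X (a div 2) (b div 2))"
  let ?r = "\<lambda>r::real. msc sm (complex_of_real r)"
  define P Q where "P = pq_n n p (e - p)" and "Q = pq_n n (e - p) p"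
  have N: "0 < N" using n by (simp add: N_def)
  have Z: "msupp N Z" "mstar st Z = Z"
    using X by (auto simp: Z_def N_def msupp_def mstar_def fun_eq_iff)
  have P: "P \<in> C N" and Q: "Q \<in> C N" using pq_n_mem n p by (auto simp: P_def Q_def N_def)
  obtain \<epsilon> where \<epsilon>: "\<epsilon> > 0" "\<And>t::real. t > 0 \<Longrightarrow> Z + ?r \<epsilon> P + ?r t Q \<notin> C N"
    using notin Z by (auto simp: cone_pq_def Z_def[symmetric] P_def Q_def N_def)
  have Pe: "?r \<epsilon> P \<in> C N" by (rule C_scale) (use N P \<epsilon> in auto)
  define Y where "Y = Z + ?r \<epsilon> P"
  have Y: "msupp N Y" "mstar st Y = Y"
    using Z C_msupp[OF N Pe] C_herm[OF N Pe] by (auto simp: Y_def msupp_def mstar_def fun_eq_iff st_add)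
  obtain \<phi> :: "(nat \<Rightarrow> nat \<Rightarrow> 'v) \<Rightarrow> complex" where
    add: "\<And>X X'. \<phi> (X + X') = \<phi> X + \<phi> X'" and sc: "\<And>c X. \<phi> (msc sm c X) = c * \<phi> X"
    and star: "\<And>X. \<phi> (mstar st X) = cnj (\<phi> X)" and pos: "\<And>X. X \<in> C N \<Longrightarrow> 0 \<le> \<phi> X"
    and \<phi>Q: "\<phi> Q = 0" and \<phi>1: "\<phi> (munit N e) = 1" and \<phi>Y: "Re (\<phi> Y) \<le> 0"
  proof (rule separating_functional[OF N Q Y])
    show "Y + ?r t Q \<notin> C N" if "0 < t" for t :: real
      using \<epsilon>(2)[OF that] by (simp add: Y_def)
  qed blast
  have \<phi>_0: "\<phi> 0 = 0" using add[of 0 0] by simp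
  have \<phi>_sum: "\<phi> (sum g B) = (\<Sum>a\<in>B. \<phi> (g a))" for g and B :: "nat set"
    by (induction B rule: infinite_finite_induct) (simp_all only: sum.infinite sum.empty sum.insert \<phi>_0 add not_False_eq_True)
  define F where "F x k l = \<phi> (mat_single k l x)" for x k l
  have F_lin: "F (sm a x + sm b y) k l = a * F x k l + b * F y k l" for a b x y k l
  proof -
    have "mat_single k l (sm a x + sm b y) = msc sm a (mat_single k l x) + msc sm b (mat_single k l y)"
      by (auto simp: mat_single_def msc_def fun_eq_iff)
    then show ?thesis by (simp add: F_def add sc)
  qed
  have \<phi>_F: "\<phi> A = (\<Sum>k<N. \<Sum>l<N. F (A k l) k l)" if "msupp N A" for A
    by (subst mat_expand[OF that]) (simp add: \<phi>_sum F_def)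
  have F: "cp_map N F" unfolding cp_map_def
  proof (intro conjI allI impI ballI)
    show "F (sm a x + sm b y) k l = a * F x k l + b * F y k l" for a b x y k l by (rule F_lin)
    show "F (st x) k l = cnj (F x l k)" for x k l
    proof -
      have "mat_single k l (st x) = mstar st (mat_single l k x)"
        by (auto simp: mat_single_def mstar_def fun_eq_iff)
      then show ?thesis by (simp add: F_def star)
    qed
    fix m :: nat and A c assume m: "0 < m" "A \<in> C m"
    \<comment> \<open>Compressing A by c, read as an m x N matrix, turns the form of F into a single
      value of \<phi>. Thus positivity of \<phi> on \<open>C N\<close> alone gives complete
      positivity of F.\<close>
    have "\<phi> (mcomp sm m N c A) = (\<Sum>k<N. \<Sum>l<N. \<Sum>i<m. \<Sum>j<m. cnj (c i k) * c j l * F (A i j) k l)"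
    proof (subst \<phi>_F)
      show "msupp N (mcomp sm m N c A)" by (simp add: msupp_def mcomp_def)
    qed (intro sum.cong refl, auto intro!: cp_mcomp[OF F_lin])
    also have "\<dots> = (\<Sum>i<m. \<Sum>j<m. sesq N (F (A i j)) (c i) (c j))"
      by (subst sum_swap4) (simp add: sesq_def mult_ac)
    finally show "0 \<le> (\<Sum>i<m. \<Sum>j<m. sesq N (F (A i j)) (c i) (c j))"
      using pos[OF C_comp[OF m(1) N m(2), of c]] by simp
  qed
  have F_diag_pos: "0 \<le> F x k k" if "mat1 x \<in> C 1" "k < N" for x k
    unfolding F_def by (rule pos) (rule C_single[OF that])
  \<comment> \<open>The sum is \<phi> Q, and its terms are nonnegative, so each of them
    vanishes.\<close>
  have "(\<Sum>k<N. F (if even k then e - p else p) k k) = 0"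
    using \<phi>Q unfolding Q_def pq_n_expand N_def \<phi>_sum F_def .
  moreover have "0 \<le> F (if even k then e - p else p) k k" if "k < N" for k
    using F_diag_pos p that by auto
  ultimately have diag0: "F (if even k then e - p else p) k k = 0" if "k < N" for k
    using that by (subst (asm) sum_nonneg_eq_0_iff) auto
  \<comment> \<open>A zero diagonal entry of a positive semidefinite matrix kills its row and its
    column.\<close>
  have null: "F q k l = 0 \<and> F q l k = 0"
    if "F q k k = 0" "mat1 q \<in> C 1" "k < N" "l < N" for q k l
  proof -
    have q_pos: "0 \<le> Re (sesq N (F q) u u)" for u
      using cp_sesq_pos[OF F that(2), of u] by (simp add: less_eq_complex_def)
    have "mstar st (mat1 q) 0 0 = mat1 q 0 0"
      using C_herm[OF _ that(2)] by simp
    then have q_st: "st q = q" by (simp add: mstar_def mat1_def)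
    have herm: "F q i j = cnj (F q j i)" for i j
      using cp_st[OF F, of q i j] q_st by simp
    have "sesq N (F q) (basis_vec k) (basis_vec l) = 0" "sesq N (F q) (basis_vec l) (basis_vec k) = 0"
      using semi_inner_null[where G = "F q", OF herm q_pos, of "basis_vec k" "basis_vec l"] that
      by (simp_all add: sesq_basis)
    then show ?thesis using that by (simp add: sesq_basis)
  qed
  have F_e: "F e k l = F p k l + F (e - p) k l" for k l
    using cp_add[OF F, of p "e - p"] by simp
  have q0: "F (e - p) k l = 0" if "k < N" "l < N" "even k \<or> even l" for k l
    using null[of "e - p" k l] null[of "e - p" l k] diag0[of k] diag0[of l] p that by auto
  have p0: "F p k l = 0" if "k < N" "l < N" "odd k \<or> odd l" for k l
    using null[of p k l] null[of p l k] diag0[of k] diag0[of l] p that by auto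
  \<comment> \<open>F p and F (e - p) live on the even and odd indices respectively, so modulo null vectors F p is
    the orthogonal projection E onto the even ones.\<close>
  define E where "E u = (\<lambda>k::nat. if even k then u k else (0::complex))" for u
  obtain d T L where T: "proj_block p d T"
    and FT: "\<And>x u v. sesq N (F x) u v = sesq d (T x) (L u) (L v)"
  proof (rule proj_block_of_cp_map[OF F, of p E])
    show "sesq N (F p) u v = sesq N (F e) (E u) (E v)" for u v
      unfolding sesq_def E_def by (intro sum.cong refl) (auto simp: F_e q0 p0)
    show "sesq N (F p) u v = sesq N (F e) (E u) v" for u v
      unfolding sesq_def E_def by (intro sum.cong refl) (auto simp: F_e q0 p0)
    show "sesq N (F p) u v = sesq N (F e) u (E v)" for u v
      unfolding sesq_def E_def by (intro sum.cong refl) (auto simp: F_e q0 p0)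
  qed blast
  have "P + Q = munit N e"
    by (auto simp: P_def Q_def N_def pq_n_def munit_def fun_eq_iff)
  then have "\<phi> P = 1" using add[of P Q] \<phi>Q \<phi>1 by simp
  then have neg: "Re (\<phi> Z) < 0" using \<phi>Y \<epsilon>(1) by (simp add: Y_def add sc)
  \<comment> \<open>\<open>c i\<close> is the indicator of the pair {2 i, 2 i + 1}. Compressing X by
    c repeats each entry in a 2 x 2 block, so \<phi> Z is the form of the matrices
    \<open>F (X i j)\<close> at these vectors.\<close>
  define c where "c i k = (if k div 2 = i then 1 else (0::complex))" for i k :: nat
  have Z_eq: "mcomp sm n N c X = Z"
  proof -
    have "c = (\<lambda>i k. if i = k div 2 then 1 else 0)" by (auto simp: c_def fun_eq_iff)
    then show ?thesis
      using X(1) by (simp add: N_def mcomp_select[where g = "\<lambda>k. k div 2" and a = "\<lambda>_. 1"] less_mult_imp_div_less mult.commute)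
        (auto simp: Z_def msupp_def fun_eq_iff)
  qed
  have "\<phi> Z = (\<Sum>k<N. \<Sum>l<N. \<Sum>i<n. \<Sum>j<n. cnj (c i k) * c j l * F (X i j) k l)"
    by (subst \<phi>_F[OF Z(1)]) (intro sum.cong refl, auto intro!: cp_mcomp[OF F_lin] simp flip: Z_eq)
  also have "\<dots> = (\<Sum>i<n. \<Sum>j<n. sesq N (F (X i j)) (c i) (c j))"
    by (subst sum_swap4) (simp add: sesq_def mult_ac)
  also have "\<dots> = (\<Sum>i<n. \<Sum>j<n. sesq d (T (X i j)) (L (c i)) (L (c j)))"
    by (simp add: FT)
  finally have "\<not> 0 \<le> (\<Sum>i<n. \<Sum>j<n. sesq d (T (X i j)) (L (c i)) (L (c j)))"
    using neg by (simp add: less_eq_complex_def)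
  then show ?thesis using T that[of d T "\<lambda>i. L (c i)"] by blast
qed

end

section \<open>Block diagonal operators\<close>

lemma has_sum_sum:
  fixes h :: "'c \<Rightarrow> 'a \<Rightarrow> 'b::topological_comm_monoid_add"
  assumes "\<And>i. i \<in> J \<Longrightarrow> (h i has_sum s i) A"
  shows "((\<lambda>x. \<Sum>i\<in>J. h i x) has_sum (\<Sum>i\<in>J. s i)) A"
  using assms by (induction J rule: infinite_finite_induct) (auto intro: has_sum_add)

text \<open>The setting of the Hilbert direct sum of the spaces \<complex>^(dim b), carried over to
  a prescribed index type by the injective labelling \<iota> of the pairs (block,
  coordinate).\<close>

locale block_l2 =
  fixes A :: "'a set" and dim :: "'a \<Rightarrow> nat" and \<iota> :: "'a \<times> nat \<Rightarrow> 'i"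
  assumes inj: "inj_on \<iota> (SIGMA b:A. {..<dim b})"
begin

definition S where "S = (SIGMA b:A. {..<dim b})"

definition I where "I = \<iota> ` S"

definition coord :: "('i \<Rightarrow> complex) \<Rightarrow> 'a \<Rightarrow> nat \<Rightarrow> complex" where
  "coord f b r = f (\<iota> (b, r))"

definition block_op :: "('a \<Rightarrow> nat \<Rightarrow> nat \<Rightarrow> complex) \<Rightarrow> ('i \<Rightarrow> complex) \<Rightarrow> 'i \<Rightarrow> complex" where
  "block_op M f i = (if i \<in> I then
     (case inv_into S \<iota> i of (b, r) \<Rightarrow> \<Sum>s<dim b. M b r s * coord f b s) else 0)"

lemma inj_S: "inj_on \<iota> S"
  using inj by (simp add: S_def)

lemma coord_block_op:
  assumes "b \<in> A" "r < dim b"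
  shows "coord (block_op M f) b r = (\<Sum>s<dim b. M b r s * coord f b s)"
proof -
  have "(b, r) \<in> S" using assms by (simp add: S_def)
  then show ?thesis by (simp add: coord_def[of "block_op M f"] block_op_def I_def inj_S)
qed

lemma eq_coordI:
  assumes "\<And>i. i \<notin> I \<Longrightarrow> f i = 0" "\<And>i. i \<notin> I \<Longrightarrow> g i = 0"
    and "\<And>b r. b \<in> A \<Longrightarrow> r < dim b \<Longrightarrow> coord f b r = coord g b r"
  shows "f = g"
proof
  fix i show "f i = g i"
  proof (cases "i \<in> I")
    case True
    then obtain b r where "b \<in> A" "r < dim b" "i = \<iota> (b, r)" by (auto simp: I_def S_def)
    then show ?thesis using assms(3)[of b r] by (simp add: coord_def)
  qed (use assms(1,2) in simp)
qed

lemma block_op_outside: "i \<notin> I \<Longrightarrow> block_op M f i = 0"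
  by (simp add: block_op_def)

lemma l2_outside: "f \<in> l2 I \<Longrightarrow> i \<notin> I \<Longrightarrow> f i = 0"
  by (simp add: l2_def)

lemma has_sum_blocks:
  fixes h :: "'i \<Rightarrow> 'c :: banach"
  assumes "h summable_on I"
  shows "((\<lambda>b. \<Sum>r<dim b. h (\<iota> (b, r))) has_sum infsum h I) A"
proof -
  have "(h has_sum infsum h I) (\<iota> ` S)" using assms by (simp add: I_def)
  then have "((h \<circ> \<iota>) has_sum infsum h I) (SIGMA b:A. {..<dim b})"
    unfolding has_sum_reindex[OF inj_S] by (simp only: S_def)
  then show ?thesis
    by (rule has_sum_SigmaD) (auto intro!: has_sum_finiteI)
qed

lemma l2_iff:
  assumes "\<And>i. i \<notin> I \<Longrightarrow> f i = 0"
  shows "f \<in> l2 I \<longleftrightarrow> (\<lambda>b. \<Sum>r<dim b. (cmod (coord f b r))\<^sup>2) summable_on A"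
proof
  assume "f \<in> l2 I"
  then have "(\<lambda>i. (cmod (f i))\<^sup>2) summable_on I" by (simp add: l2_def)
  from has_sum_blocks[OF this] show "(\<lambda>b. \<Sum>r<dim b. (cmod (coord f b r))\<^sup>2) summable_on A"
    by (auto simp: summable_on_def coord_def)
next
  assume s: "(\<lambda>b. \<Sum>r<dim b. (cmod (coord f b r))\<^sup>2) summable_on A"
  have "((\<lambda>i. (cmod (f i))\<^sup>2) \<circ> \<iota>) summable_on (SIGMA b:A. {..<dim b})"
    using s by (rule summable_on_SigmaI[rotated]) (auto simp: coord_def intro!: has_sum_finiteI)
  then have "(\<lambda>i. (cmod (f i))\<^sup>2) summable_on I"
    unfolding I_def summable_on_reindex[OF inj_S] by (simp only: S_def)
  then show "f \<in> l2 I" using assms by (simp add: l2_def)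
qed

lemma l2_norm_blocks:
  assumes "f \<in> l2 I"
  shows "l2_norm I f = sqrt (\<Sum>\<^sub>\<infinity>b\<in>A. \<Sum>r<dim b. (cmod (coord f b r))\<^sup>2)"
proof -
  have "(\<lambda>i. (cmod (f i))\<^sup>2) summable_on I" using assms by (simp add: l2_def)
  from has_sum_blocks[OF this, THEN infsumI] show ?thesis by (simp add: l2_norm_def coord_def)
qed

lemma inner_blocks:
  assumes "f \<in> l2 I" "g \<in> l2 I"
  shows "((\<lambda>b. \<Sum>r<dim b. cnj (coord f b r) * coord g b r) has_sum l2_inner I f g) A"
proof -
  have "(\<lambda>i. (cmod (f i))\<^sup>2 + (cmod (g i))\<^sup>2) summable_on I"
    using assms by (intro summable_on_add) (simp_all add: l2_def)
  then have "(\<lambda>i. norm (cnj (f i) * g i)) summable_on I"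
  proof (rule Infinite_Sum.abs_summable_on_comparison_test')
    fix i
    have "2 * (cmod (f i) * cmod (g i)) \<le> (cmod (f i))\<^sup>2 + (cmod (g i))\<^sup>2"
      using sum_squares_bound[of "cmod (f i)" "cmod (g i)"] by (simp add: mult.assoc)
    moreover have "0 \<le> cmod (f i) * cmod (g i)" by simp
    ultimately show "norm (cnj (f i) * g i) \<le> (cmod (f i))\<^sup>2 + (cmod (g i))\<^sup>2"
      by (simp only: norm_mult complex_mod_cnj)
  qed
  then have "(\<lambda>i. cnj (f i) * g i) summable_on I" by (rule abs_summable_summable)
  from has_sum_blocks[OF this] show ?thesis by (simp add: l2_inner_def coord_def)
qed

text \<open>One constant K serves all blocks; this uniformity is what bounds the direct sum.\<close>

definition block_bounded :: "('a \<Rightarrow> nat \<Rightarrow> nat \<Rightarrow> complex) \<Rightarrow> bool" where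
  "block_bounded M \<longleftrightarrow> (\<exists>K\<ge>0. \<forall>b\<in>A. \<forall>v. (\<Sum>r<dim b. (cmod (\<Sum>s<dim b. M b r s * v s))\<^sup>2)
      \<le> K\<^sup>2 * (\<Sum>r<dim b. (cmod (v r))\<^sup>2))"

lemma block_op_bounded:
  assumes "block_bounded M"
  shows "bounded_op I (block_op M)"
proof -
  obtain K where K: "K \<ge> 0" "\<And>b v. b \<in> A \<Longrightarrow> (\<Sum>r<dim b. (cmod (\<Sum>s<dim b. M b r s * v s))\<^sup>2)
      \<le> K\<^sup>2 * (\<Sum>r<dim b. (cmod (v r))\<^sup>2)"
    using assms unfolding block_bounded_def by blast
  have le: "(\<Sum>r<dim b. (cmod (coord (block_op M f) b r))\<^sup>2) \<le> K\<^sup>2 * (\<Sum>r<dim b. (cmod (coord f b r))\<^sup>2)"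
    if "b \<in> A" for b f
    using K(2)[OF that, of "coord f b"] that by (simp add: coord_block_op)
  have s: "(\<lambda>b. \<Sum>r<dim b. (cmod (coord f b r))\<^sup>2) summable_on A" if "f \<in> l2 I" for f
    using l2_iff[of f] l2_outside[OF that] that by blast
  have l2: "block_op M f \<in> l2 I" if f: "f \<in> l2 I" for f
  proof -
    have "(\<lambda>b. \<Sum>r<dim b. (cmod (coord (block_op M f) b r))\<^sup>2) summable_on A"
      by (rule summable_on_comparison_test[OF summable_on_cmult_right[OF s[OF f]]])
        (auto intro: le sum_nonneg)
    then show ?thesis using l2_iff block_op_outside by blast
  qed
  show ?thesis unfolding bounded_op_def
  proof (intro conjI ballI allI exI)
    show "block_op M f \<in> l2 I" if "f \<in> l2 I" for f using l2 that .
    show "block_op M (\<lambda>i. a * f i + b * g i) = (\<lambda>i. a * block_op M f i + b * block_op M g i)" for f g a b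
      by (auto simp: block_op_def coord_def fun_eq_iff sum.distrib sum_distrib_left algebra_simps split: prod.splits)
    fix f assume f: "f \<in> l2 I"
    have "(\<Sum>\<^sub>\<infinity>b\<in>A. \<Sum>r<dim b. (cmod (coord (block_op M f) b r))\<^sup>2)
        \<le> (\<Sum>\<^sub>\<infinity>b\<in>A. K\<^sup>2 * (\<Sum>r<dim b. (cmod (coord f b r))\<^sup>2))"
      by (rule infsum_mono[OF s[OF l2[OF f]] summable_on_cmult_right[OF s[OF f]] le])
    also have "\<dots> = K\<^sup>2 * (\<Sum>\<^sub>\<infinity>b\<in>A. \<Sum>r<dim b. (cmod (coord f b r))\<^sup>2)"
      by (rule infsum_cmult_right) (rule s[OF f])
    finally have "l2_norm I (block_op M f) \<le> sqrt (K\<^sup>2 * (\<Sum>\<^sub>\<infinity>b\<in>A. \<Sum>r<dim b. (cmod (coord f b r))\<^sup>2))"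
      unfolding l2_norm_blocks[OF l2[OF f]] by (rule real_sqrt_le_mono)
    then show "l2_norm I (block_op M f) \<le> K * l2_norm I f"
      using K(1) unfolding l2_norm_blocks[OF f] by (simp add: real_sqrt_mult)
  qed
qed

lemma inner_block_op:
  assumes "block_bounded M" "f \<in> l2 I" "g \<in> l2 I"
  shows "((\<lambda>b. sesq (dim b) (M b) (coord f b) (coord g b)) has_sum l2_inner I f (block_op M g)) A"
proof -
  have "block_op M g \<in> l2 I" using block_op_bounded[OF assms(1)] assms(3) by (simp add: bounded_op_def)
  from inner_blocks[OF assms(2) this] show ?thesis
    by (rule has_sum_cong[THEN iffD1, rotated])
      (simp add: coord_block_op sesq_def sum_distrib_left mult_ac)
qed

lemma inner_block_op_left:
  assumes "block_bounded M" "f \<in> l2 I" "g \<in> l2 I"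
  shows "((\<lambda>b. cnj (sesq (dim b) (M b) (coord g b) (coord f b))) has_sum l2_inner I (block_op M f) g) A"
proof -
  have "block_op M f \<in> l2 I" using block_op_bounded[OF assms(1)] assms(2) by (simp add: bounded_op_def)
  from inner_blocks[OF this assms(3)] show ?thesis
    by (rule has_sum_cong[THEN iffD1, rotated])
      (simp add: coord_block_op sesq_def sum_distrib_left sum_distrib_right mult_ac)
qed

definition block_vec :: "'a \<Rightarrow> (nat \<Rightarrow> complex) \<Rightarrow> 'i \<Rightarrow> complex" where
  "block_vec b v i = (if i \<in> \<iota> ` ({b} \<times> {..<dim b}) then v (snd (inv_into S \<iota> i)) else 0)"

lemma coord_block_vec:
  assumes "b \<in> A" "b' \<in> A" "r < dim b'"
  shows "coord (block_vec b v) b' r = (if b' = b then v r else 0)"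
proof -
  have r: "(b', r) \<in> S" using assms by (simp add: S_def)
  have "\<iota> (b', r) \<in> \<iota> ` ({b} \<times> {..<dim b}) \<longleftrightarrow> (b', r) \<in> {b} \<times> {..<dim b}"
    by (rule inj_on_image_mem_iff[OF inj_S r]) (use assms(1) in \<open>auto simp: S_def\<close>)
  also have "\<dots> \<longleftrightarrow> b' = b" using assms(3) by auto
  finally show ?thesis
    unfolding coord_def block_vec_def inv_into_f_f[OF inj_S r] by simp
qed

lemma block_vec_l2:
  assumes "b \<in> A"
  shows "block_vec b v \<in> l2 I"
proof -
  have "(\<lambda>b'. \<Sum>r<dim b'. (cmod (coord (block_vec b v) b' r))\<^sup>2) summable_on A
      \<longleftrightarrow> (\<lambda>b'. \<Sum>r<dim b'. (cmod (coord (block_vec b v) b' r))\<^sup>2) summable_on {b}"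
    by (rule summable_on_cong_neutral) (use assms in \<open>auto simp: coord_block_vec\<close>)
  then show ?thesis
    by (subst l2_iff) (use assms in \<open>auto simp: block_vec_def I_def S_def\<close>)
qed

text \<open>Vectors supported in a single block reduce the form on \<open>l2 I\<close> to that
  block, which gives one direction. For the other, the form is a convergent sum of nonnegative
  contributions of the blocks.\<close>

lemma op_mat_pos_block_op:
  assumes M: "\<And>i j. i < n \<Longrightarrow> j < n \<Longrightarrow> block_bounded (M i j)"
  shows "op_mat_pos I n (\<lambda>i j. block_op (M i j)) \<longleftrightarrow>
    (\<forall>b\<in>A. \<forall>c. 0 \<le> (\<Sum>i<n. \<Sum>j<n. sesq (dim b) (M i j b) (c i) (c j)))"
proof -
  have sum: "((\<lambda>b. \<Sum>i<n. \<Sum>j<n. sesq (dim b) (M i j b) (coord (fs i) b) (coord (fs j) b)) has_sum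
      (\<Sum>i<n. \<Sum>j<n. l2_inner I (fs i) (block_op (M i j) (fs j)))) A"
    if "\<And>k. k < n \<Longrightarrow> fs k \<in> l2 I" for fs
    using that M by (intro has_sum_sum inner_block_op) auto
  show ?thesis
  proof (intro iffI ballI allI)
    fix b c assume pos: "op_mat_pos I n (\<lambda>i j. block_op (M i j))" and b: "b \<in> A"
    define fs where "fs k = block_vec b (c k)" for k :: nat
    have "((\<lambda>b'. \<Sum>i<n. \<Sum>j<n. sesq (dim b') (M i j b') (coord (fs i) b') (coord (fs j) b')) has_sum
        (\<Sum>i<n. \<Sum>j<n. sesq (dim b) (M i j b) (coord (fs i) b) (coord (fs j) b))) A"
      by (rule has_sum_finite_neutralI[of "{b}"])
        (use b in \<open>auto intro!: sum.neutral simp: sesq_def fs_def coord_block_vec\<close>)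
    then have "(\<Sum>i<n. \<Sum>j<n. l2_inner I (fs i) (block_op (M i j) (fs j)))
        = (\<Sum>i<n. \<Sum>j<n. sesq (dim b) (M i j b) (coord (fs i) b) (coord (fs j) b))"
      using sum[of fs] by (auto simp: fs_def block_vec_l2[OF b] intro: has_sum_unique)
    also have "\<dots> = (\<Sum>i<n. \<Sum>j<n. sesq (dim b) (M i j b) (c i) (c j))"
      by (intro sum.cong refl sesq_cong) (use b in \<open>simp_all add: fs_def coord_block_vec\<close>)
    finally have eq: "(\<Sum>i<n. \<Sum>j<n. l2_inner I (fs i) (block_op (M i j) (fs j)))
        = (\<Sum>i<n. \<Sum>j<n. sesq (dim b) (M i j b) (c i) (c j))" .
    have "\<forall>k<n. fs k \<in> l2 I" by (simp add: fs_def block_vec_l2[OF b])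
    then show "0 \<le> (\<Sum>i<n. \<Sum>j<n. sesq (dim b) (M i j b) (c i) (c j))"
      using pos unfolding op_mat_pos_def Let_def less_eq_complex_def eq[symmetric] by auto
  next
    assume pos: "\<forall>b\<in>A. \<forall>c. 0 \<le> (\<Sum>i<n. \<Sum>j<n. sesq (dim b) (M i j b) (c i) (c j))"
    show "op_mat_pos I n (\<lambda>i j. block_op (M i j))"
      unfolding op_mat_pos_def Let_def
    proof (intro allI impI)
      fix fs assume "\<forall>k<n. fs k \<in> l2 I"
      then have s: "((\<lambda>b. \<Sum>i<n. \<Sum>j<n. sesq (dim b) (M i j b) (coord (fs i) b) (coord (fs j) b)) has_sum
          (\<Sum>i<n. \<Sum>j<n. l2_inner I (fs i) (block_op (M i j) (fs j)))) A"
        by (intro sum) auto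
      have "0 \<le> (\<Sum>\<^sub>\<infinity>b\<in>A. \<Sum>i<n. \<Sum>j<n. sesq (dim b) (M i j b) (coord (fs i) b) (coord (fs j) b))"
        by (rule infsum_nonneg_complex) (use s pos in \<open>auto simp: summable_on_def\<close>)
      then show "Im (\<Sum>i<n. \<Sum>j<n. l2_inner I (fs i) (block_op (M i j) (fs j))) = 0 \<and>
          0 \<le> Re (\<Sum>i<n. \<Sum>j<n. l2_inner I (fs i) (block_op (M i j) (fs j)))"
        unfolding infsumI[OF s] by (simp add: less_eq_complex_def)
    qed
  qed
qed

end

text \<open>A triple is recorded as a set of functions: the constant function records d and r, and the
  value at 0, where T vanishes, tells the remaining functions apart.\<close>

definition block_code :: "(nat \<times> ('v::zero \<Rightarrow> nat \<Rightarrow> nat \<Rightarrow> complex)) \<times> nat \<Rightarrow> ('v \<Rightarrow> complex) set" where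
  "block_code = (\<lambda>((d, T), r). insert (\<lambda>_. - of_nat (Suc (prod_encode (d, r))))
     {(\<lambda>v. T v k l + of_nat (prod_encode (k, l))) | k l. True})"

lemma block_code_inj:
  assumes eq: "block_code ((d, T), r) = block_code ((d', T'), r')"
    and T: "\<And>k l. T 0 k l = 0" "\<And>k l. T' 0 k l = 0"
  shows "d = d' \<and> T = T' \<and> r = r'"
proof -
  define c where "c m = (\<lambda>_::'a. - (of_nat (Suc m) :: complex))" for m
  define g where "g T k l = (\<lambda>v::'a. T v k l + (of_nat (prod_encode (k, l)) :: complex))" for T k l
  have code: "block_code ((d, T), r) = insert (c (prod_encode (d, r))) {g T k l | k l. True}" for d T r
    by (simp add: block_code_def c_def g_def)
  \<comment> \<open>The \<open>Suc\<close> matters here: at 0 the constant function is at most -1,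
    while \<open>g U k l\<close> has the value \<open>prod_encode (k, l)\<close> \<ge> 0. So the
    constant can be recognised within the set.\<close>
  have ne: "c m \<noteq> g U k l" if "\<And>k l. U 0 k l = 0" for m U k l
  proof
    assume "c m = g U k l"
    then have "Re (c m 0) = Re (g U k l 0)" by simp
    then show False using that by (simp add: c_def g_def)
  qed
  have "c (prod_encode (d, r)) \<in> block_code ((d', T'), r')" using eq code by blast
  then have "c (prod_encode (d, r)) = c (prod_encode (d', r'))" using ne[where U = T', OF T(2)] code by auto
  then have "prod_encode (d, r) = prod_encode (d', r')"
    unfolding c_def by (metis neg_equal_iff_equal of_nat_eq_iff nat.inject)
  moreover have "T v k l = T' v k l" for v k l
  proof -
    have "g T k l \<in> insert (c (prod_encode (d', r'))) {g T' k l | k l. True}"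
      using eq code by blast
    moreover have "g T k l \<noteq> c (prod_encode (d', r'))"
      by (rule not_sym, rule ne, rule T(1))
    ultimately obtain k' l' where kl: "g T k l = g T' k' l'" by blast
    have "g T k l 0 = g T' k' l' 0" using kl by simp
    then have "k = k'" "l = l'" by (simp_all add: g_def T)
    then show ?thesis using fun_cong[OF kl, of v] by (simp add: g_def)
  qed
  ultimately show ?thesis by (simp add: fun_eq_iff)
qed

section \<open>Testing the order on all blocks, and the direct sum of the blocks\<close>

context op_sys begin

lemma mem_cone_iff:
  assumes p: "abstract_projection sm st C e p" and n: "0 < n" and X: "msupp n X"
  shows "X \<in> C n \<longleftrightarrow>
    (\<forall>d T c. proj_block p d T \<longrightarrow> 0 \<le> (\<Sum>i<n. \<Sum>j<n. sesq d (T (X i j)) (c i) (c j)))"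
proof
  show "X \<in> C n \<Longrightarrow> \<forall>d T c. proj_block p d T \<longrightarrow> 0 \<le> (\<Sum>i<n. \<Sum>j<n. sesq d (T (X i j)) (c i) (c j))"
    using cp_pos[OF _ n] by (auto simp: proj_block_def)
next
  have herm: "Y \<in> C n"
    if Y: "msupp n Y" "mstar st Y = Y"
      and pos: "\<And>d T c. proj_block p d T \<Longrightarrow> 0 \<le> (\<Sum>i<n. \<Sum>j<n. sesq d (T (Y i j)) (c i) (c j))" for Y
  proof (rule ccontr)
    assume "Y \<notin> C n"
    then have q: "\<not> quot_cone_mem sm st C p (e - p) n (\<lambda>i j. pi2 (Y i j))"
      using p n Y(1) unfolding abstract_projection_def Let_def by blast
    \<comment> \<open>The blocks of Z are \<open>pi2 (Y i j)\<close> exactly, not just modulo J. As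
      0 is in J, membership of Z in the cone of p \<oplus> e - p would put the image of Y into the
      quotient cone.\<close>
    define Z where "Z = (\<lambda>a b. Y (a div 2) (b div 2))"
    have "blk Z i j = pi2 (Y i j)" for i j
      by (auto simp: blk_def pi2_def Z_def fun_eq_iff)
    moreover have "(0 :: nat \<Rightarrow> nat \<Rightarrow> 'v) \<in> J_pq sm st C p (e - p)"
      unfolding J_pq_def by (auto intro!: exI[of _ "0::nat"] simp: fun_eq_iff)
    ultimately have Z: "Z \<notin> cone_pq sm st C p (e - p) n"
      using q unfolding quot_cone_mem_def by auto
    have p_pos: "mat1 p \<in> C 1" "mat1 (e - p) \<in> C 1"
      using p by (simp_all add: abstract_projection_def Let_def)
    show False
      by (rule separating_block[OF p_pos n Y Z[unfolded Z_def]]) (use pos in blast)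
  qed
  assume pos: "\<forall>d T c. proj_block p d T \<longrightarrow> 0 \<le> (\<Sum>i<n. \<Sum>j<n. sesq d (T (X i j)) (c i) (c j))"
  \<comment> \<open>The skew part of X pairs to 0 with every block, so it vanishes by the hermitian case.\<close>
  define B where "B = msc sm \<i> (X - mstar st X)"
  have B: "msupp n B" "mstar st B = B"
    using X by (auto simp: B_def msupp_def msc_def mstar_def fun_eq_iff st_sm st_diff scale_right_diff_distrib)
  have B0: "(\<Sum>i<n. \<Sum>j<n. sesq d (T (B i j)) (c i) (c j)) = 0" if "proj_block p d T" for d T c
  proof -
    have T: "cp_map d T" using that by (simp add: proj_block_def)
    define s where "s = (\<Sum>i<n. \<Sum>j<n. sesq d (T (X i j)) (c i) (c j))"
    have "(\<Sum>i<n. \<Sum>j<n. sesq d (T (st (X j i))) (c i) (c j)) = cnj (\<Sum>i<n. \<Sum>j<n. sesq d (T (X j i)) (c j) (c i))"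
      by (simp add: cp_sesq_st[OF T])
    also have "\<dots> = cnj s" unfolding s_def by (subst sum.swap) simp
    finally have star: "(\<Sum>i<n. \<Sum>j<n. sesq d (T (st (X j i))) (c i) (c j)) = cnj s" .
    have "B i j = sm \<i> (X i j + sm (-1) (st (X j i)))" for i j
      by (simp add: B_def msc_def mstar_def)
    then have "(\<Sum>i<n. \<Sum>j<n. sesq d (T (B i j)) (c i) (c j))
        = (\<Sum>i<n. \<Sum>j<n. \<i> * sesq d (T (X i j)) (c i) (c j) - \<i> * sesq d (T (st (X j i))) (c i) (c j))"
      by (simp only: cp_sesq_sm[OF T] cp_sesq_add[OF T]) (simp add: algebra_simps)
    also have "\<dots> = \<i> * s - \<i> * cnj s"
      unfolding star[symmetric] by (simp add: s_def sum_subtractf sum_distrib_left)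
    also have "\<dots> = 0"
    proof -
      have "0 \<le> s" using pos that by (simp add: s_def)
      then show ?thesis by (simp add: less_eq_complex_def complex_eq_iff)
    qed
    finally show ?thesis .
  qed
  have "B \<in> C n" by (rule herm[OF B]) (simp add: B0)
  moreover have "- B \<in> C n"
  proof (rule herm)
    show "msupp n (- B)" "mstar st (- B) = - B"
      using B by (auto simp: msupp_def mstar_def fun_eq_iff st_minus)
    fix d T c assume T: "proj_block p d T"
    then have cp: "cp_map d T" by (simp add: proj_block_def)
    have "(- B) i j = sm (-1) (B i j)" for i j by simp
    then have "(\<Sum>i<n. \<Sum>j<n. sesq d (T ((- B) i j)) (c i) (c j))
        = - (\<Sum>i<n. \<Sum>j<n. sesq d (T (B i j)) (c i) (c j))"
      by (simp only: cp_sesq_sm[OF cp]) (simp add: sum_negf)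
    then show "0 \<le> (\<Sum>i<n. \<Sum>j<n. sesq d (T ((- B) i j)) (c i) (c j))" using B0[OF T] by simp
  qed
  ultimately have "B = 0" using C_antisym n by blast
  then have "msc sm (- \<i>) B = 0" by (simp add: msc_def zero_fun_def)
  then have "X - mstar st X = 0" by (simp add: B_def msc_def fun_eq_iff)
  then have "mstar st X = X" by simp
  then show "X \<in> C n" using herm X pos by blast
qed

text \<open>The constant of \<open>cp_bound\<close> depends on x alone and bounds the operator norm
  of \<open>T x\<close> for all blocks at once.\<close>

lemma proj_block_bound:
  "\<exists>K>0. \<forall>d T v. proj_block p d T \<longrightarrow>
     (\<Sum>r<d. (cmod (\<Sum>s<d. T x r s * v s))\<^sup>2) \<le> K\<^sup>2 * (\<Sum>r<d. (cmod (v r))\<^sup>2)"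
proof -
  obtain k where k: "k > 0" "\<And>d T u v. cp_map d T \<Longrightarrow>
     0 \<le> k * Re (sesq d (T e) u u) + 2 * Re (sesq d (T x) u v) + k * Re (sesq d (T e) v v)"
    using cp_bound[of x] by blast
  have "(\<Sum>r<d. (cmod (\<Sum>s<d. T x r s * v s))\<^sup>2) \<le> k\<^sup>2 * (\<Sum>r<d. (cmod (v r))\<^sup>2)"
    if T: "proj_block p d T" for d T v
  proof -
    define w where "w r = (\<Sum>s<d. T x r s * v s)" for r
    define W V where "W = (\<Sum>r<d. (cmod (w r))\<^sup>2)" and "V = (\<Sum>r<d. (cmod (v r))\<^sup>2)"
    have sq: "cnj z * z = complex_of_real ((cmod z)\<^sup>2)" for z
      by (metis complex_norm_square mult.commute)
    have e: "sesq d (T e) u u = complex_of_real (\<Sum>r<d. (cmod (u r))\<^sup>2)" for u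
    proof -
      have "sesq d (T e) u u = (\<Sum>r<d. \<Sum>s<d. if s = r then cnj (u r) * u r else 0)"
        unfolding sesq_def using T by (intro sum.cong refl) (auto simp: proj_block_def)
      then show ?thesis by (simp add: sq)
    qed
    have "sesq d (T x) w v = (\<Sum>r<d. cnj (w r) * (\<Sum>s<d. T x r s * v s))"
      by (simp add: sesq_def sum_distrib_left mult.assoc)
    also have "\<dots> = (\<Sum>r<d. cnj (w r) * w r)" by (simp only: w_def)
    finally have wv: "sesq d (T x) w v = complex_of_real W" by (simp add: sq W_def)
    \<comment> \<open>With u = s w the bound reads 0 \<le> k s^2 W + 2 s W + k V. The choice s =
      -1/k minimises the right-hand side and gives W \<le> k^2 V.\<close>
    have "0 \<le> k * Re (sesq d (T e) (\<lambda>r. complex_of_real (- (1/k)) * w r) (\<lambda>r. complex_of_real (- (1/k)) * w r))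
        + 2 * Re (sesq d (T x) (\<lambda>r. complex_of_real (- (1/k)) * w r) v) + k * Re (sesq d (T e) v v)"
      using k(2) T by (simp only: proj_block_def)
    then have "0 \<le> W / k - 2 * (W / k) + k * V"
      unfolding sesq_scale_left sesq_scale_right e wv using k(1)
      by (simp add: W_def[symmetric] V_def[symmetric] field_simps)
    then have "W \<le> k\<^sup>2 * V" using k(1) by (simp add: field_simps power2_eq_square)
    then show ?thesis by (simp add: W_def V_def w_def)
  qed
  with k(1) show ?thesis by blast
qed

lemma projection_embedding:
  assumes p: "abstract_projection sm st C e p"
  shows "\<exists>(I :: ('v \<Rightarrow> complex) set set) \<pi>.
    unital_complete_order_embedding sm C e I \<pi> \<and> is_projection I (\<pi> p)"
proof -
  \<comment> \<open>Taking every block, instead of choosing one for each matrix outside a cone,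
    turns the order test for the direct sum into exactly the condition of
    \<open>mem_cone_iff\<close>.\<close>
  define A where "A = {(d, T). proj_block p d T}"
  have cp: "cp_map (fst b) (snd b)" if "b \<in> A" for b
    using that by (auto simp: A_def proj_block_def)
  interpret B: block_l2 A fst "block_code :: _ \<Rightarrow> ('v \<Rightarrow> complex) set"
  proof
    show "inj_on (block_code :: _ \<Rightarrow> ('v \<Rightarrow> complex) set) (SIGMA b:A. {..<fst b})"
    proof (rule inj_onI)
      fix x y :: "(nat \<times> ('v \<Rightarrow> nat \<Rightarrow> nat \<Rightarrow> complex)) \<times> nat"
      assume xy: "x \<in> (SIGMA b:A. {..<fst b})" "y \<in> (SIGMA b:A. {..<fst b})" "block_code x = block_code y"
      obtain d T r d' T' r' where d: "x = ((d, T), r)" "y = ((d', T'), r')" by (metis prod.collapse)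
      have "T 0 k l = 0" "T' 0 k l = 0" for k l
        using cp_0[OF cp[of "(d, T)"]] cp_0[OF cp[of "(d', T')"]] xy d by auto
      then have "d = d' \<and> T = T' \<and> r = r'"
        using xy(3) unfolding d by (intro block_code_inj) auto
      then show "x = y" by (simp add: d)
    qed
  qed
  define \<pi> where "\<pi> x = B.block_op (\<lambda>b. snd b x)" for x
  have bd: "B.block_bounded (\<lambda>b. snd b x)" for x
  proof -
    obtain K where "K > 0" "\<forall>d T v. proj_block p d T \<longrightarrow>
        (\<Sum>r<d. (cmod (\<Sum>s<d. T x r s * v s))\<^sup>2) \<le> K\<^sup>2 * (\<Sum>r<d. (cmod (v r))\<^sup>2)"
      using proj_block_bound by blast
    then show ?thesis unfolding B.block_bounded_def by (intro exI[of _ K]) (auto simp: A_def)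
  qed
  have bop: "bounded_op B.I (\<pi> x)" for x
    unfolding \<pi>_def by (rule B.block_op_bounded[OF bd])
  have lin: "\<pi> (sm a x + sm b y) f = (\<lambda>i. a * \<pi> x f i + b * \<pi> y f i)" for a b x y f
  proof (rule B.eq_coordI)
    fix c r assume c: "c \<in> A" "r < fst c"
    have "B.coord (\<lambda>i. a * \<pi> x f i + b * \<pi> y f i) c r = a * B.coord (\<pi> x f) c r + b * B.coord (\<pi> y f) c r"
      by (simp add: B.coord_def)
    then show "B.coord (\<pi> (sm a x + sm b y) f) c r = B.coord (\<lambda>i. a * \<pi> x f i + b * \<pi> y f i) c r"
      using c by (simp add: \<pi>_def B.coord_block_op cp_linear[OF cp] algebra_simps sum.distrib sum_distrib_left)
  qed (simp_all add: \<pi>_def B.block_op_outside)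
  have unit: "\<pi> e f = f" if f: "f \<in> l2 B.I" for f
  proof (rule B.eq_coordI)
    fix c r assume c: "c \<in> A" "r < fst c"
    have "B.coord (\<pi> e f) c r = (\<Sum>s<fst c. if s = r then B.coord f c s else 0)"
      unfolding \<pi>_def B.coord_block_op[OF c] using c
      by (intro sum.cong refl) (auto simp: A_def proj_block_def)
    then show "B.coord (\<pi> e f) c r = B.coord f c r" using c by simp
  qed (use B.l2_outside[OF f] in \<open>simp_all add: \<pi>_def B.block_op_outside\<close>)
  have order: "X \<in> C n \<longleftrightarrow> op_mat_pos B.I n (\<lambda>i j. \<pi> (X i j))" if "0 < n" "msupp n X" for n X
    unfolding mem_cone_iff[OF p that] \<pi>_def
    by (subst B.op_mat_pos_block_op[OF bd]) (auto simp: A_def)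
  \<comment> \<open>Injectivity follows from the order: if \<pi> x = 0, then x and -x both pass the
    positivity test, and \<open>C 1\<close> contains no nonzero element together with its
    negative.\<close>
  have \<pi>_null: "x = 0" if "\<And>f. f \<in> l2 B.I \<Longrightarrow> \<pi> x f = (\<lambda>_. 0)" for x
  proof -
    have "\<pi> (- x) f = (\<lambda>_. 0)" if "f \<in> l2 B.I" for f
      using lin[of "-1" x 0 x f] \<open>\<And>f. f \<in> l2 B.I \<Longrightarrow> \<pi> x f = (\<lambda>_. 0)\<close>[OF that] by simp
    moreover have "msupp 1 (mat1 x)" "msupp 1 (- mat1 x)" by (auto simp: msupp_def mat1_def)
    ultimately have "mat1 x \<in> C 1" "- mat1 x \<in> C 1"
      using that by (simp_all add: order op_mat_pos_def mat1_def l2_inner_def)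
    then have "mat1 x = 0" by (intro C_antisym[of 1]) auto
    then have "mat1 x 0 0 = 0" by simp
    then show ?thesis by (simp add: mat1_def)
  qed
  have inj: "x = y" if "\<forall>f\<in>l2 B.I. \<pi> x f = \<pi> y f" for x y
    using \<pi>_null[of "x - y"] lin[of 1 x "-1" y] that by simp
  have "unital_complete_order_embedding sm C e B.I \<pi>"
    unfolding unital_complete_order_embedding_def
    using bop lin unit inj order by blast
  moreover have "is_projection B.I (\<pi> p)"
    unfolding is_projection_def
  proof (intro conjI ballI bop)
    fix f assume "f \<in> l2 B.I"
    show "\<pi> p (\<pi> p f) = \<pi> p f"
    proof (rule B.eq_coordI)
      fix c r assume c: "c \<in> A" "r < fst c"
      have "B.coord (\<pi> p (\<pi> p f)) c r
          = (\<Sum>t<fst c. \<Sum>s<fst c. snd c p r t * snd c p t s * B.coord f c s)"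
        using c by (simp add: \<pi>_def B.coord_block_op sum_distrib_left mult_ac)
      also have "\<dots> = (\<Sum>s<fst c. (\<Sum>t<fst c. snd c p r t * snd c p t s) * B.coord f c s)"
        by (subst sum.swap) (simp add: sum_distrib_right)
      also have "\<dots> = B.coord (\<pi> p f) c r"
        unfolding \<pi>_def B.coord_block_op[OF c] using c
        by (intro sum.cong refl) (auto simp: A_def proj_block_def)
      finally show "B.coord (\<pi> p (\<pi> p f)) c r = B.coord (\<pi> p f) c r" .
    qed (simp_all add: \<pi>_def B.block_op_outside)
  next
    fix f g assume fg: "f \<in> l2 B.I" "g \<in> l2 B.I"
    \<comment> \<open>Members of \<open>C 1\<close> are hermitian, so st p = p. The blocks of \<pi>
      p are then hermitian, because the maps respect adjoints.\<close>
    have "mstar st (mat1 p) 0 0 = mat1 p 0 0"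
      using p C_herm[of 1 "mat1 p"] by (simp add: abstract_projection_def Let_def)
    then have "st p = p" by (simp add: mstar_def mat1_def)
    then have adj: "cnj (sesq (fst b) (snd b p) v u) = sesq (fst b) (snd b p) u v" if "b \<in> A" for b u v
      using cp_sesq_st[OF cp[OF that], of p u v] by simp
    have "((\<lambda>b. sesq (fst b) (snd b p) (B.coord f b) (B.coord g b)) has_sum l2_inner B.I (\<pi> p f) g) A"
      using B.inner_block_op_left[OF bd[of p] fg] unfolding \<pi>_def
      by (rule has_sum_cong[THEN iffD1, rotated]) (simp add: adj)
    then show "l2_inner B.I (\<pi> p f) g = l2_inner B.I f (\<pi> p g)"
      using B.inner_block_op[OF bd[of p] fg] unfolding \<pi>_def by (rule has_sum_unique)
  qed
  ultimately show ?thesis by blast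
qed

end

theorem theorem5p7:
  fixes sm :: "complex \<Rightarrow> 'v::ab_group_add \<Rightarrow> 'v"
    and st :: "'v \<Rightarrow> 'v"
    and C :: "nat \<Rightarrow> (nat \<Rightarrow> nat \<Rightarrow> 'v) set"
    and e p :: 'v
  assumes "operator_system sm st C e"
    and "abstract_projection sm st C e p"
  shows "\<exists>(I :: ('v \<Rightarrow> complex) set set) \<pi>.
           unital_complete_order_embedding sm C e I \<pi> \<and> is_projection I (\<pi> p)"
proof -
  interpret op_sys sm st C e by unfold_locales (rule assms(1))
  show ?thesis by (rule projection_embedding[OF assms(2)])
qed

end
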